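(* Let $K$ be a field, $k$ a positive integer, and $\Lambda$ a row-finite $k$-graph without sources for which the Kumjian-Pask algebra $KP_K(\Lambda)$ is simple. Then the following holds: (1) If $\Lambda^0$ is finite, then $Z(KP_K(\Lambda)) = K\cdot 1_{KP_K(\Lambda)}$. (2) If $\Lambda^0$ is infinite, then $Z(KP_K(\Lambda)) = 0$.
   Context: View $\mathbb{N}^k$ (with $0\in\mathbb{N}$) as a category with one object. A $k$-graph is a countable category $\Lambda=(\Lambda^0,\Lambda,s,r)$ with a functor $d:\Lambda\to\mathbb{N}^k$ (the degree map) satisfying the factorisation property: if $\lambda\in\Lambda$ and $d(\lambda)=m+n$ with $m,n\in\mathbb{N}^k$, there are unique $\mu,\nu\in\Lambda$ with $d(\mu)=m$, $d(\nu)=n$ and $\lambda=\mu\nu$. Morphisms $\lambda$ go from $s(\lambda)$ to $r(\lambda)$, and $\lambda\mu=\lambda\circ\mu$ is defined iff $s(\lambda)=r(\mu)$. The object set $\Lambda^0$ is identified with the set of morphisms of degree $0$; $\Lambda^n:=d^{-1}(n)$ and $v\Lambda^n:=\{\lambda\in\Lambda^n\mid r(\lambda)=v\}$. $\Lambda$ is row-finite if $v\Lambda^n$ is finite, and has no sources if $v\Lambda^n$ is nonempty, for every $v\in\Lambda^0$ and $n\in\mathbb{N}^k$. The Kumjian-Pask algebra $KP_K(\Lambda)$ of a row-finite $k$-graph without sources is the $K$-algebra (not necessarily unital) generated by $\Lambda\cup\Lambda^*$, where $\Lambda^*=\{\lambda^*\mid\lambda\in\Lambda\}$ is a set of ghost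 paths with the convention $v^*=v$ for $v\in\Lambda^0$, subject to ($\delta$ the Kronecker delta): (KP1) $vw=\delta_{v,w}w$ for all $v,w\in\Lambda^0$; (KP2) $\lambda\mu=\lambda\circ\mu$ and $\mu^*\lambda^*=(\lambda\circ\mu)^*$ for all $\lambda,\mu\in\Lambda$ with $r(\mu)=s(\lambda)$; (KP3) $\lambda^*\mu=\delta_{\lambda,\mu}s(\lambda)$ for all $\lambda,\mu\in\Lambda$ with $d(\lambda)=d(\mu)$; (KP4) $v=\sum_{\lambda\in v\Lambda^n}\lambda\lambda^*$ for all $v\in\Lambda^0$ and $n\in\mathbb{N}^k\setminus\{0\}$. $KP_K(\Lambda)$ is unital if and only if $\Lambda^0$ is finite, and then its identity is $1_{KP_K(\Lambda)}=\sum_{v\in\Lambda^0}v$. $Z(R)$ denotes the center of a ring $R$. *)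

theory Defs
  imports "HOL-Analysis.Finite_Cartesian_Product" "HOL-Library.Poly_Mapping"
    "HOL-Library.Countable_Set"
begin

section \<open>Higher-rank graphs\<close>

record ('o, 'm) cat =
  Obj :: "'o set"
  Mor :: "'m set"
  src :: "'m \<Rightarrow> 'o"
  rng :: "'m \<Rightarrow> 'o"
  idm :: "'o \<Rightarrow> 'm"
  cmp :: "'m \<Rightarrow> 'm \<Rightarrow> 'm"

text \<open>Composition is written in functional order: \<open>cmp C f g\<close> is meaningful iff
  \<open>src C f = rng C g\<close>. Values outside the indicated domains are irrelevant.\<close>

locale small_category =
  fixes C :: "('o, 'm, 'x) cat_scheme"
  assumes src_closed: "f \<in> Mor C \<Longrightarrow> src C f \<in> Obj C"
    and rng_closed: "f \<in> Mor C \<Longrightarrow> rng C f \<in> Obj C"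
    and idm_closed: "v \<in> Obj C \<Longrightarrow> idm C v \<in> Mor C"
    and src_idm: "v \<in> Obj C \<Longrightarrow> src C (idm C v) = v"
    and rng_idm: "v \<in> Obj C \<Longrightarrow> rng C (idm C v) = v"
    and cmp_closed: "\<lbrakk>f \<in> Mor C; g \<in> Mor C; src C f = rng C g\<rbrakk> \<Longrightarrow> cmp C f g \<in> Mor C"
    and src_cmp: "\<lbrakk>f \<in> Mor C; g \<in> Mor C; src C f = rng C g\<rbrakk> \<Longrightarrow> src C (cmp C f g) = src C g"
    and rng_cmp: "\<lbrakk>f \<in> Mor C; g \<in> Mor C; src C f = rng C g\<rbrakk> \<Longrightarrow> rng C (cmp C f g) = rng C f"
    and cmp_idm_left: "f \<in> Mor C \<Longrightarrow> cmp C (idm C (rng C f)) f = f"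
    and cmp_idm_right: "f \<in> Mor C \<Longrightarrow> cmp C f (idm C (src C f)) = f"
    and cmp_assoc: "\<lbrakk>f \<in> Mor C; g \<in> Mor C; h \<in> Mor C; src C f = rng C g; src C g = rng C h\<rbrakk>
      \<Longrightarrow> cmp C (cmp C f g) h = cmp C f (cmp C g h)"

text \<open>The rank is the cardinality of the finite index type \<open>'k\<close>, which ranges over all
  positive integers; \<open>nat ^ 'k\<close> carries the componentwise addition.\<close>

record ('o, 'm, 'k) kgraph = "('o, 'm) cat" +
  deg :: "'m \<Rightarrow> nat ^ ('k::finite)"

locale k_graph = small_category \<Lambda>
  for \<Lambda> :: "('o, 'm, 'k::finite) kgraph" +
  assumes countable_Mor: "countable (Mor \<Lambda>)"
    and deg_idm: "v \<in> Obj \<Lambda> \<Longrightarrow> deg \<Lambda> (idm \<Lambda> v) = 0"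
    and deg_cmp: "\<lbrakk>f \<in> Mor \<Lambda>; g \<in> Mor \<Lambda>; src \<Lambda> f = rng \<Lambda> g\<rbrakk>
      \<Longrightarrow> deg \<Lambda> (cmp \<Lambda> f g) = deg \<Lambda> f + deg \<Lambda> g"
    and factorisation: "\<lbrakk>l \<in> Mor \<Lambda>; deg \<Lambda> l = m + n\<rbrakk> \<Longrightarrow>
      \<exists>!(\<mu>, \<nu>). \<mu> \<in> Mor \<Lambda> \<and> \<nu> \<in> Mor \<Lambda> \<and> src \<Lambda> \<mu> = rng \<Lambda> \<nu> \<and>
        deg \<Lambda> \<mu> = m \<and> deg \<Lambda> \<nu> = n \<and> l = cmp \<Lambda> \<mu> \<nu>"

definition paths_to :: "('o, 'm, 'k::finite) kgraph \<Rightarrow> 'o \<Rightarrow> nat ^ 'k \<Rightarrow> 'm set" where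
  "paths_to \<Lambda> v n = {l \<in> Mor \<Lambda>. deg \<Lambda> l = n \<and> rng \<Lambda> l = v}"

definition row_finite :: "('o, 'm, 'k::finite) kgraph \<Rightarrow> bool" where
  "row_finite \<Lambda> \<longleftrightarrow> (\<forall>v \<in> Obj \<Lambda>. \<forall>n. finite (paths_to \<Lambda> v n))"

definition no_sources :: "('o, 'm, 'k::finite) kgraph \<Rightarrow> bool" where
  "no_sources \<Lambda> \<longleftrightarrow> (\<forall>v \<in> Obj \<Lambda>. \<forall>n. paths_to \<Lambda> v n \<noteq> {})"


section \<open>Algebras that need not be unital\<close>

record ('f, 'a) alg =
  acarrier :: "'a set"
  aadd :: "'a \<Rightarrow> 'a \<Rightarrow> 'a"
  azero :: "'a"
  amult :: "'a \<Rightarrow> 'a \<Rightarrow> 'a"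
  ascale :: "'f \<Rightarrow> 'a \<Rightarrow> 'a"

text \<open>Two-sided ideals; over a field, closure under scalars includes closure under negation.\<close>

definition alg_ideal :: "('f, 'a) alg \<Rightarrow> 'a set \<Rightarrow> bool" where
  "alg_ideal A I \<longleftrightarrow> I \<subseteq> acarrier A \<and> azero A \<in> I \<and>
     (\<forall>x \<in> I. \<forall>y \<in> I. aadd A x y \<in> I) \<and>
     (\<forall>c. \<forall>x \<in> I. ascale A c x \<in> I) \<and>
     (\<forall>a \<in> acarrier A. \<forall>x \<in> I. amult A a x \<in> I \<and> amult A x a \<in> I)"

definition alg_genideal :: "('f, 'a) alg \<Rightarrow> 'a set \<Rightarrow> 'a set" where
  "alg_genideal A S = \<Inter>{I. alg_ideal A I \<and> S \<subseteq> I}"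

definition alg_coset :: "('f, 'a) alg \<Rightarrow> 'a set \<Rightarrow> 'a \<Rightarrow> 'a set" where
  "alg_coset A I a = {aadd A a x | x. x \<in> I}"

definition alg_quot :: "('f, 'a) alg \<Rightarrow> 'a set \<Rightarrow> ('f, 'a set) alg" where
  "alg_quot A I =
    \<lparr>acarrier = alg_coset A I ` acarrier A,
     aadd = (\<lambda>X Y. \<Union>x \<in> X. \<Union>y \<in> Y. alg_coset A I (aadd A x y)),
     azero = alg_coset A I (azero A),
     amult = (\<lambda>X Y. \<Union>x \<in> X. \<Union>y \<in> Y. alg_coset A I (amult A x y)),
     ascale = (\<lambda>c X. \<Union>x \<in> X. alg_coset A I (ascale A c x))\<rparr>"

text \<open>As usual for algebras without identity, simplicity includes \<open>A A \<noteq> 0\<close>.\<close>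

definition alg_simple :: "('f, 'a) alg \<Rightarrow> bool" where
  "alg_simple A \<longleftrightarrow>
     (\<exists>a \<in> acarrier A. \<exists>b \<in> acarrier A. amult A a b \<noteq> azero A) \<and>
     (\<forall>I. alg_ideal A I \<longrightarrow> I = {azero A} \<or> I = acarrier A)"

definition alg_center :: "('f, 'a) alg \<Rightarrow> 'a set" where
  "alg_center A = {z \<in> acarrier A. \<forall>a \<in> acarrier A. amult A z a = amult A a z}"


section \<open>The free algebra without identity\<close>

text \<open>Words form a monoid under concatenation, so \<open>'g word \<Rightarrow>\<^sub>0 'f\<close> with the convolution
  product of \<^theory>\<open>HOL-Library.Poly_Mapping\<close> is the free unital algebra on \<open>'g\<close>.\<close>

datatype 'g word = Word (letters: "'g list")

instantiation word :: (type) monoid_add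
begin

definition zero_word :: "'a word" where "0 = Word []"

definition plus_word :: "'a word \<Rightarrow> 'a word \<Rightarrow> 'a word" where
  "u + v = Word (letters u @ letters v)"

instance
  by standard (simp_all add: zero_word_def plus_word_def)

end

text \<open>The free algebra on \<open>G\<close> that need not be unital consists of the elements supported on
  nonempty words in letters from \<open>G\<close>. Scalars act as multiples of the empty word.\<close>

definition free_alg :: "'g set \<Rightarrow> ('f::field, 'g word \<Rightarrow>\<^sub>0 'f) alg" where
  "free_alg G =
    \<lparr>acarrier = {p. \<forall>w \<in> Poly_Mapping.keys p. w \<noteq> 0 \<and> set (letters w) \<subseteq> G},
     aadd = (+),
     azero = 0,
     amult = (*),
     ascale = (\<lambda>c p. Poly_Mapping.single 0 c * p)\<rparr>"


section \<open>Kumjian-Pask algebras\<close>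

datatype 'm kp_letter = Path 'm | Ghost 'm

definition kp_letters :: "('o, 'm, 'k::finite) kgraph \<Rightarrow> 'm kp_letter set" where
  "kp_letters \<Lambda> = Path ` Mor \<Lambda> \<union> Ghost ` Mor \<Lambda>"

abbreviation kp_path :: "'m \<Rightarrow> 'm kp_letter word \<Rightarrow>\<^sub>0 'f::field" where
  "kp_path l \<equiv> Poly_Mapping.single (Word [Path l]) 1"

abbreviation kp_ghost :: "'m \<Rightarrow> 'm kp_letter word \<Rightarrow>\<^sub>0 'f::field" where
  "kp_ghost l \<equiv> Poly_Mapping.single (Word [Ghost l]) 1"

text \<open>Each relation \<open>a = b\<close> is recorded as the element \<open>a - b\<close>. A vertex \<open>v\<close>, viewed as a path
  of degree \<open>0\<close>, is \<open>idm \<Lambda> v\<close>; \<open>kp0\<close> is the convention \<open>v\<^sup>* = v\<close>.\<close>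

definition kp0 :: "('o, 'm, 'k::finite) kgraph \<Rightarrow> ('m kp_letter word \<Rightarrow>\<^sub>0 'f::field) set" where
  "kp0 \<Lambda> = {kp_ghost (idm \<Lambda> v) - kp_path (idm \<Lambda> v) | v. v \<in> Obj \<Lambda>}"

definition kp1 :: "('o, 'm, 'k::finite) kgraph \<Rightarrow> ('m kp_letter word \<Rightarrow>\<^sub>0 'f::field) set" where
  "kp1 \<Lambda> = {kp_path (idm \<Lambda> v) * kp_path (idm \<Lambda> w) - (if v = w then kp_path (idm \<Lambda> w) else 0)
     | v w. v \<in> Obj \<Lambda> \<and> w \<in> Obj \<Lambda>}"

definition kp2 :: "('o, 'm, 'k::finite) kgraph \<Rightarrow> ('m kp_letter word \<Rightarrow>\<^sub>0 'f::field) set" where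
  "kp2 \<Lambda> =
     {kp_path l * kp_path m - kp_path (cmp \<Lambda> l m)
       | l m. l \<in> Mor \<Lambda> \<and> m \<in> Mor \<Lambda> \<and> rng \<Lambda> m = src \<Lambda> l} \<union>
     {kp_ghost m * kp_ghost l - kp_ghost (cmp \<Lambda> l m)
       | l m. l \<in> Mor \<Lambda> \<and> m \<in> Mor \<Lambda> \<and> rng \<Lambda> m = src \<Lambda> l}"

definition kp3 :: "('o, 'm, 'k::finite) kgraph \<Rightarrow> ('m kp_letter word \<Rightarrow>\<^sub>0 'f::field) set" where
  "kp3 \<Lambda> = {kp_ghost l * kp_path m - (if l = m then kp_path (idm \<Lambda> (src \<Lambda> l)) else 0)
     | l m. l \<in> Mor \<Lambda> \<and> m \<in> Mor \<Lambda> \<and> deg \<Lambda> l = deg \<Lambda> m}"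

definition kp4 :: "('o, 'm, 'k::finite) kgraph \<Rightarrow> ('m kp_letter word \<Rightarrow>\<^sub>0 'f::field) set" where
  "kp4 \<Lambda> = {kp_path (idm \<Lambda> v) - (\<Sum>l \<in> paths_to \<Lambda> v n. kp_path l * kp_ghost l)
     | v n. v \<in> Obj \<Lambda> \<and> n \<noteq> 0}"

definition kp_ideal :: "('o, 'm, 'k::finite) kgraph \<Rightarrow> ('m kp_letter word \<Rightarrow>\<^sub>0 'f::field) set" where
  "kp_ideal \<Lambda> =
     alg_genideal (free_alg (kp_letters \<Lambda>)) (kp0 \<Lambda> \<union> kp1 \<Lambda> \<union> kp2 \<Lambda> \<union> kp3 \<Lambda> \<union> kp4 \<Lambda>)"

definition kp_alg ::
  "'f itself \<Rightarrow> ('o, 'm, 'k::finite) kgraph \<Rightarrow> ('f::field, ('m kp_letter word \<Rightarrow>\<^sub>0 'f) set) alg" where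
  "kp_alg K \<Lambda> = alg_quot (free_alg (kp_letters \<Lambda>)) (kp_ideal \<Lambda>)"

text \<open>The class of the sum of all vertices, which is the identity if there are finitely many.\<close>

definition kp_one ::
  "'f itself \<Rightarrow> ('o, 'm, 'k::finite) kgraph \<Rightarrow> ('m kp_letter word \<Rightarrow>\<^sub>0 'f::field) set" where
  "kp_one K \<Lambda> =
     alg_coset (free_alg (kp_letters \<Lambda>)) (kp_ideal \<Lambda>) (\<Sum>v \<in> Obj \<Lambda>. kp_path (idm \<Lambda> v))"

end

theory Submission
  imports Defs
begin

text \<open>
  Let \<open>A\<close> be the Kumjian-Pask algebra, assumed simple, and let \<open>z\<close> be a central element. The idea is
  to show that \<open>z\<close> acts on \<open>A\<close> as multiplication by a scalar \<open>c\<close>. Computations take place in the free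
  algebra modulo the ideal generated by the relations.

  Counting paths with their degree and ghost paths with minus their degree makes all relations
  homogeneous, so \<open>A\<close> is graded by \<open>\<int>\<^sup>k\<close>, and the components of a central element are central
  (\<open>central_component\<close>). In a simple algebra a nonzero central element is not a zero divisor, and the
  elements \<open>b - z b\<close> form an ideal. If \<open>z\<close> were nonzero and homogeneous of degree \<open>n \<noteq> 0\<close>, this ideal
  would be everything, so that a vertex, which has degree \<open>0\<close>, would be of the form \<open>b - z b\<close>. Since
  \<open>b\<close> has only finitely many components, comparing degrees along the multiples of \<open>n\<close> shows that the
  vertex is zero, which is absurd (\<open>central_homogeneous_vanishes\<close>). Hence a central element is
  homogeneous of degree \<open>0\<close>.

  If \<open>z\<close> has degree \<open>0\<close> and \<open>l\<close> is a path whose degree is large compared with the words occurring in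
  \<open>z\<close>, then each of these words sends \<open>l\<close> to zero or to a path of the same degree as \<open>l\<close>. Therefore
  \<open>l\<^sup>* z l = c s(l)\<close> for a scalar \<open>c\<close> (\<open>degree_0_compression\<close>). For central \<open>z\<close> the left side equals
  \<open>z l\<^sup>* l = z s(l)\<close>. The elements \<open>a\<close> with \<open>z a = c a\<close> form an ideal, which contains \<open>s(l) \<noteq> 0\<close>; so
  \<open>z a = c a\<close> for all \<open>a\<close> (\<open>central_acts_as_scalar\<close>).

  If there are finitely many vertices, their sum is the identity, and \<open>z = c 1\<close>. If there are
  infinitely many, some vertex \<open>v\<close> satisfies \<open>v z = 0\<close>, because only finitely many words occur in
  \<open>z\<close>; so \<open>c v = 0\<close>, hence \<open>c = 0\<close>, hence \<open>z A = 0\<close> and \<open>z = 0\<close>.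

  All this rests on the vertices being nonzero in \<open>A\<close> (\<open>vertex_not_in_kp_ideal\<close>). That follows by
  letting words act on paths: a path acts by prolongation, a ghost path by removing an initial
  segment. All relations hold on paths of sufficiently large degree, and a vertex fixes arbitrarily
  large paths because there are no sources.
\<close>

section \<open>Ideals and quotients of free algebras\<close>

lemma sum_monomials:
  fixes p :: "'a \<Rightarrow>\<^sub>0 'b::comm_monoid_add"
  shows "(\<Sum>w\<in>Poly_Mapping.keys p. Poly_Mapping.single w (Poly_Mapping.lookup p w)) = p"
  by (rule poly_mapping_eqI)
    (auto simp: lookup_sum lookup_single when_def sum.delta in_keys_iff)

abbreviation free_carrier :: "'g set \<Rightarrow> ('g word \<Rightarrow>\<^sub>0 'f::field) set" where
  "free_carrier G \<equiv> acarrier (free_alg G)"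

lemma free_alg_simps:
  "aadd (free_alg G) = (+)" "azero (free_alg G) = 0" "amult (free_alg G) = (*)"
  "ascale (free_alg G) = (\<lambda>c p. Poly_Mapping.single 0 c * p)"
  by (simp_all add: free_alg_def)

lemma free_carrier_iff:
  "p \<in> free_carrier G \<longleftrightarrow>
     (\<forall>w\<in>Poly_Mapping.keys p. w \<noteq> 0 \<and> set (letters w) \<subseteq> G)"
  by (simp add: free_alg_def)

lemma zero_in_free_carrier [simp]: "0 \<in> free_carrier G"
  by (simp add: free_carrier_iff)

lemma single_in_free_carrier:
  "w \<noteq> 0 \<Longrightarrow> set (letters w) \<subseteq> G \<Longrightarrow> Poly_Mapping.single w c \<in> free_carrier G"
  by (simp add: free_carrier_iff)

lemma letter_in_free_carrier: "x \<in> G \<Longrightarrow> Poly_Mapping.single (Word [x]) c \<in> free_carrier G"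
  by (simp add: free_carrier_iff zero_word_def)

lemma add_in_free_carrier: "p \<in> free_carrier G \<Longrightarrow> q \<in> free_carrier G \<Longrightarrow> p + q \<in> free_carrier G"
  using keys_add[of p q] by (auto simp: free_carrier_iff)

lemma plus_word_eq_0_iff: "u + v = (0 :: 'g word) \<longleftrightarrow> u = 0 \<and> v = 0"
  by (cases u; cases v) (simp add: plus_word_def zero_word_def)

lemma letters_plus: "letters (u + v) = letters u @ letters v"
  by (simp add: plus_word_def)

lemma mult_in_free_carrier:
  "p \<in> free_carrier G \<Longrightarrow> q \<in> free_carrier G \<Longrightarrow> p * q \<in> free_carrier G"
  using keys_mult[of p q] by (fastforce simp: free_carrier_iff plus_word_eq_0_iff letters_plus)

lemma scale_in_free_carrier:
  assumes "p \<in> free_carrier G"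
  shows "Poly_Mapping.single 0 c * p \<in> free_carrier G"
proof -
  have "Poly_Mapping.keys (Poly_Mapping.single 0 c * p) \<subseteq> Poly_Mapping.keys p"
    using keys_mult[of "Poly_Mapping.single 0 c" p] by (auto split: if_splits)
  then show ?thesis
    using assms by (auto simp: free_carrier_iff)
qed

lemma uminus_in_free_carrier: "p \<in> free_carrier G \<Longrightarrow> - p \<in> free_carrier G"
  using scale_in_free_carrier[of p G "- 1"] by (simp add: single_uminus)

lemma diff_in_free_carrier:
  "p \<in> free_carrier G \<Longrightarrow> q \<in> free_carrier G \<Longrightarrow> p - q \<in> free_carrier G"
  using add_in_free_carrier[of p G "- q"] by (simp add: uminus_in_free_carrier)

lemma sum_in_free_carrier:
  "(\<And>x. x \<in> X \<Longrightarrow> f x \<in> free_carrier G) \<Longrightarrow> sum f X \<in> free_carrier G"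
  by (induction X rule: infinite_finite_induct) (simp_all add: add_in_free_carrier)

lemma free_carrier_induct [consumes 1, case_names zero monomial add]:
  assumes "p \<in> free_carrier G"
    and "P 0"
    and "\<And>w c. w \<noteq> 0 \<Longrightarrow> set (letters w) \<subseteq> G \<Longrightarrow> P (Poly_Mapping.single w c)"
    and "\<And>p q. p \<in> free_carrier G \<Longrightarrow> q \<in> free_carrier G \<Longrightarrow> P p \<Longrightarrow> P q \<Longrightarrow> P (p + q)"
  shows "P p"
proof -
  let ?m = "\<lambda>w. Poly_Mapping.single w (Poly_Mapping.lookup p w)"
  have "P (\<Sum>w\<in>W. ?m w) \<and> (\<Sum>w\<in>W. ?m w) \<in> free_carrier G"
    if "finite W" "W \<subseteq> Poly_Mapping.keys p" for W
    using that
  proof (induction W rule: finite_induct)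
    case empty
    then show ?case using assms(2) by simp
  next
    case (insert w W)
    then have "P (?m w)" "?m w \<in> free_carrier G"
      using assms(1,3) by (auto simp: free_carrier_iff)
    with insert show ?case
      by (simp add: assms(4) add_in_free_carrier)
  qed
  from this[of "Poly_Mapping.keys p"] show ?thesis
    by (simp add: sum_monomials)
qed

lemma scale_commute:
  fixes p :: "'g word \<Rightarrow>\<^sub>0 'f::field"
  shows "p * Poly_Mapping.single 0 c = Poly_Mapping.single 0 c * p"
proof -
  have "(\<Sum>w\<in>Poly_Mapping.keys p. Poly_Mapping.single w (Poly_Mapping.lookup p w))
          * Poly_Mapping.single 0 c
      = Poly_Mapping.single 0 c
          * (\<Sum>w\<in>Poly_Mapping.keys p. Poly_Mapping.single w (Poly_Mapping.lookup p w))"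
    by (simp add: sum_distrib_left sum_distrib_right mult_single mult.commute)
  then show ?thesis by (simp add: sum_monomials)
qed

lemma scale_left_commute:
  fixes p q :: "'g word \<Rightarrow>\<^sub>0 'f::field"
  shows "p * (Poly_Mapping.single 0 c * q) = Poly_Mapping.single 0 c * (p * q)"
  by (simp only: mult.assoc[symmetric] scale_commute)

lemma ideal_CollectI:
  assumes "P 0"
    and "\<And>p q. p \<in> free_carrier G \<Longrightarrow> q \<in> free_carrier G \<Longrightarrow> P p \<Longrightarrow> P q \<Longrightarrow> P (p + q)"
    and "\<And>c p. p \<in> free_carrier G \<Longrightarrow> P p \<Longrightarrow> P (Poly_Mapping.single 0 c * p)"
    and "\<And>a p. a \<in> free_carrier G \<Longrightarrow> p \<in> free_carrier G \<Longrightarrow> P p \<Longrightarrow> P (a * p)"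
    and "\<And>a p. a \<in> free_carrier G \<Longrightarrow> p \<in> free_carrier G \<Longrightarrow> P p \<Longrightarrow> P (p * a)"
  shows "alg_ideal (free_alg G) {p \<in> free_carrier G. P p}"
  using assms
  by (simp add: alg_ideal_def free_alg_simps subset_iff add_in_free_carrier mult_in_free_carrier
      scale_in_free_carrier)

lemma genideal_ideal:
  assumes "S \<subseteq> free_carrier G"
  shows "alg_ideal (free_alg G) (alg_genideal (free_alg G) S)"
proof -
  have "alg_ideal (free_alg G) (free_carrier G)"
    by (simp add: alg_ideal_def free_alg_simps add_in_free_carrier mult_in_free_carrier
        scale_in_free_carrier)
  with assms have "alg_genideal (free_alg G) S \<subseteq> free_carrier G"
    by (auto simp: alg_genideal_def)
  then show ?thesis
    by (auto simp: alg_ideal_def alg_genideal_def)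
qed

lemma genideal_superset: "S \<subseteq> alg_genideal A S"
  by (auto simp: alg_genideal_def)

lemma genideal_least: "alg_ideal A J \<Longrightarrow> S \<subseteq> J \<Longrightarrow> alg_genideal A S \<subseteq> J"
  by (auto simp: alg_genideal_def)

locale free_alg_quot =
  fixes G :: "'g set" and I :: "('g word \<Rightarrow>\<^sub>0 'f::field) set"
  assumes ideal: "alg_ideal (free_alg G) I"
begin

abbreviation "F \<equiv> free_carrier G"

abbreviation "Q \<equiv> alg_quot (free_alg G) I"

definition cong :: "('g word \<Rightarrow>\<^sub>0 'f) \<Rightarrow> ('g word \<Rightarrow>\<^sub>0 'f) \<Rightarrow> bool" (infix "\<approx>" 50)
  where "p \<approx> q \<longleftrightarrow> p - q \<in> I"

lemma I_subset: "p \<in> I \<Longrightarrow> p \<in> F"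
  and I_zero [simp]: "0 \<in> I"
  and I_add: "p \<in> I \<Longrightarrow> q \<in> I \<Longrightarrow> p + q \<in> I"
  and I_scale: "p \<in> I \<Longrightarrow> Poly_Mapping.single 0 c * p \<in> I"
  and I_mult_left: "a \<in> F \<Longrightarrow> p \<in> I \<Longrightarrow> a * p \<in> I"
  and I_mult_right: "a \<in> F \<Longrightarrow> p \<in> I \<Longrightarrow> p * a \<in> I"
  using ideal by (auto simp: alg_ideal_def free_alg_simps)

lemma I_uminus: "p \<in> I \<Longrightarrow> - p \<in> I"
  using I_scale[of p "- 1"] by (simp add: single_uminus)

lemma I_diff: "p \<in> I \<Longrightarrow> q \<in> I \<Longrightarrow> p - q \<in> I"
  using I_add[of p "- q"] by (simp add: I_uminus)

lemma cong_refl [simp]: "p \<approx> p"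
  by (simp add: cong_def)

lemma cong_sym: "p \<approx> q \<Longrightarrow> q \<approx> p"
  using I_uminus[of "p - q"] by (simp add: cong_def)

lemma cong_trans [trans]: "p \<approx> q \<Longrightarrow> q \<approx> r \<Longrightarrow> p \<approx> r"
  using I_add[of "p - q" "q - r"] by (simp add: cong_def)

lemma cong_0_iff: "p \<approx> 0 \<longleftrightarrow> p \<in> I"
  by (simp add: cong_def)

lemma cong_in_I: "p \<approx> q \<Longrightarrow> p \<in> I \<longleftrightarrow> q \<in> I"
  by (metis cong_0_iff cong_sym cong_trans)

lemma cong_add: "p \<approx> q \<Longrightarrow> p' \<approx> q' \<Longrightarrow> p + p' \<approx> q + q'"
  using I_add[of "p - q" "p' - q'"] by (simp add: cong_def algebra_simps)

lemma cong_diff: "p \<approx> q \<Longrightarrow> p' \<approx> q' \<Longrightarrow> p - p' \<approx> q - q'"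
  using I_diff[of "p - q" "p' - q'"] by (simp add: cong_def algebra_simps)

lemma cong_scale: "p \<approx> q \<Longrightarrow> Poly_Mapping.single 0 c * p \<approx> Poly_Mapping.single 0 c * q"
  using I_scale[of "p - q" c] by (simp add: cong_def algebra_simps)

lemma cong_mult_left: "a \<in> F \<Longrightarrow> p \<approx> q \<Longrightarrow> a * p \<approx> a * q"
  using I_mult_left[of a "p - q"] by (simp add: cong_def algebra_simps)

lemma cong_mult_right: "a \<in> F \<Longrightarrow> p \<approx> q \<Longrightarrow> p * a \<approx> q * a"
  using I_mult_right[of a "p - q"] by (simp add: cong_def algebra_simps)

lemma cong_sum: "(\<And>x. x \<in> X \<Longrightarrow> f x \<approx> g x) \<Longrightarrow> sum f X \<approx> sum g X"
  by (induction X rule: infinite_finite_induct) (simp_all add: cong_add)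

definition central :: "('g word \<Rightarrow>\<^sub>0 'f) \<Rightarrow> bool"
  where "central z \<longleftrightarrow> z \<in> F \<and> (\<forall>a\<in>F. z * a \<approx> a * z)"

abbreviation coset :: "('g word \<Rightarrow>\<^sub>0 'f) \<Rightarrow> ('g word \<Rightarrow>\<^sub>0 'f) set"
  where "coset \<equiv> alg_coset (free_alg G) I"

lemma mem_coset: "q \<in> coset p \<longleftrightarrow> q \<approx> p"
  by (force simp: alg_coset_def free_alg_simps cong_def)

lemma coset_eq_iff: "coset p = coset q \<longleftrightarrow> p \<approx> q"
proof
  assume "coset p = coset q"
  then show "p \<approx> q" using mem_coset[of p p] mem_coset[of p q] by simp
next
  assume "p \<approx> q"
  then have "r \<approx> p \<longleftrightarrow> r \<approx> q" for r
    using cong_trans cong_sym by blast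
  then show "coset p = coset q" by (simp add: set_eq_iff mem_coset)
qed

text \<open>The operations of the quotient are unions over representatives. Such a union has the expected
  value once its members do not depend on the representative.\<close>

lemma union_coset:
  assumes "\<And>q. q \<approx> p \<Longrightarrow> f q = f p"
  shows "(\<Union>q\<in>coset p. f q) = f p"
proof -
  have "f ` coset p = {f p}"
  proof (intro equalityI subsetI)
    fix X assume "X \<in> f ` coset p"
    then obtain q where "q \<in> coset p" "X = f q" by (rule imageE) iprover
    then show "X \<in> {f p}" using assms[of q] by (simp add: mem_coset)
  next
    fix X assume "X \<in> {f p}"
    moreover have "f p \<in> f ` coset p" by (rule imageI) (simp add: mem_coset)
    ultimately show "X \<in> f ` coset p" by simp
  qed
  then show ?thesis by simp
qed

lemma quot_carrier: "acarrier Q = coset ` F"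
  and quot_zero: "azero Q = coset 0"
  by (simp_all add: alg_quot_def free_alg_simps)

lemma quot_scale: "ascale Q c (coset p) = coset (Poly_Mapping.single 0 c * p)"
  unfolding alg_quot_def free_alg_simps by (simp add: union_coset coset_eq_iff cong_scale)

lemma quot_add: "aadd Q (coset p) (coset q) = coset (p + q)"
proof -
  have "(\<Union>y\<in>coset q. coset (x + y)) = coset (x + q)" for x
    by (intro union_coset) (simp add: coset_eq_iff cong_add)
  then show ?thesis
    unfolding alg_quot_def free_alg_simps by (simp add: union_coset coset_eq_iff cong_add)
qed

lemma quot_mult:
  assumes "p \<in> F" "q \<in> F"
  shows "amult Q (coset p) (coset q) = coset (p * q)"
proof -
  have F: "x \<in> F" if "x \<approx> p" for x
    using add_in_free_carrier[OF I_subset assms(1), of "x - p"] that by (simp add: cong_def)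
  have "(\<Union>y\<in>coset q. coset (x * y)) = coset (x * q)" if "x \<approx> p" for x
    by (intro union_coset) (simp add: coset_eq_iff cong_mult_left F that)
  then have "(\<Union>x\<in>coset p. \<Union>y\<in>coset q. coset (x * y)) = (\<Union>x\<in>coset p. coset (x * q))"
    by (auto simp: mem_coset)
  also have "\<dots> = coset (p * q)"
    by (intro union_coset) (simp add: coset_eq_iff cong_mult_right assms)
  finally show ?thesis
    unfolding alg_quot_def free_alg_simps by simp
qed

lemma quot_center: "alg_center Q = coset ` {z. central z}"
proof -
  have "coset z \<in> alg_center Q \<longleftrightarrow> central z" if z: "z \<in> F" for z
  proof -
    have "amult Q (coset z) (coset a) = amult Q (coset a) (coset z) \<longleftrightarrow> z * a \<approx> a * z"
      if "a \<in> F" for a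
      using z that by (simp only: quot_mult coset_eq_iff)
    with z show ?thesis
      by (simp add: alg_center_def quot_carrier central_def)
  qed
  moreover have "alg_center Q \<subseteq> coset ` F" "\<And>z. central z \<Longrightarrow> z \<in> F"
    by (auto simp: alg_center_def quot_carrier central_def)
  ultimately show ?thesis by blast
qed

end

locale simple_free_alg_quot = free_alg_quot +
  assumes simple: "alg_simple (alg_quot (free_alg G) I)"
begin

lemma mult_nonzero: "\<exists>a\<in>F. \<exists>b\<in>F. a * b \<notin> I"
  using simple
  by (auto simp: alg_simple_def quot_carrier quot_mult quot_zero coset_eq_iff cong_0_iff)

lemma ideal_dichotomy:
  assumes "alg_ideal (free_alg G) J" "I \<subseteq> J" "x \<in> J" "x \<notin> I" and p: "p \<in> F"
  shows "p \<in> J"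
proof -
  have J: "J \<subseteq> F" "0 \<in> J" "\<And>p q. p \<in> J \<Longrightarrow> q \<in> J \<Longrightarrow> p + q \<in> J"
    "\<And>c p. p \<in> J \<Longrightarrow> Poly_Mapping.single 0 c * p \<in> J"
    "\<And>a p. a \<in> F \<Longrightarrow> p \<in> J \<Longrightarrow> a * p \<in> J \<and> p * a \<in> J"
    using assms(1) by (auto simp: alg_ideal_def free_alg_simps)
  have mult: "amult Q (coset a) (coset p) \<in> coset ` J \<and> amult Q (coset p) (coset a) \<in> coset ` J"
    if "a \<in> F" "p \<in> J" for a p
  proof -
    have "p \<in> F" using that J(1) by blast
    with that J(5)[OF that] show ?thesis by (simp only: quot_mult imageI simp_thms)
  qed
  have "alg_ideal Q (coset ` J)"
    unfolding alg_ideal_def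
  proof (intro conjI ballI allI)
    show "coset ` J \<subseteq> acarrier Q" "azero Q \<in> coset ` J"
      by (simp_all only: quot_carrier quot_zero image_mono[OF J(1)] imageI[OF J(2)])
    show "aadd Q X Y \<in> coset ` J" if XY: "X \<in> coset ` J" "Y \<in> coset ` J" for X Y
    proof -
      from XY obtain p q where "p \<in> J" "q \<in> J" "X = coset p" "Y = coset q" by blast
      then show ?thesis by (simp only: quot_add imageI[OF J(3)])
    qed
    show "ascale Q c X \<in> coset ` J" if X: "X \<in> coset ` J" for c X
    proof -
      from X obtain p where "p \<in> J" "X = coset p" by blast
      then show ?thesis by (simp only: quot_scale imageI[OF J(4)])
    qed
    show "amult Q Y X \<in> coset ` J" "amult Q X Y \<in> coset ` J"
      if YX: "Y \<in> acarrier Q" "X \<in> coset ` J" for X Y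
    proof -
      from YX obtain a p where "a \<in> F" "Y = coset a" "p \<in> J" "X = coset p"
        unfolding quot_carrier by blast
      then show "amult Q Y X \<in> coset ` J" "amult Q X Y \<in> coset ` J"
        by (simp_all only: mult simp_thms)
    qed
  qed
  with simple have "coset ` J = {coset 0} \<or> coset ` J = coset ` F"
    by (simp add: alg_simple_def quot_carrier quot_zero)
  moreover have "coset ` J \<noteq> {coset 0}"
  proof
    assume "coset ` J = {coset 0}"
    then have "coset x = coset 0" using imageI[OF assms(3), of coset] by simp
    with assms(4) show False by (simp only: coset_eq_iff cong_0_iff)
  qed
  ultimately have eq: "coset ` J = coset ` F" by simp
  from p have "coset p \<in> coset ` J" unfolding eq by (rule imageI)
  then obtain q where "q \<in> J" "coset p = coset q" by blast
  then have q: "q \<in> J" "p \<approx> q" by (simp_all only: coset_eq_iff)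
  then have "q + (p - q) \<in> J"
    using assms(2) by (intro J(3)) (auto simp: cong_def)
  then show ?thesis by simp
qed

text \<open>The form in which simplicity gets used: a property that defines an ideal and holds for one
  nonzero element holds for every element.\<close>

lemma ideal_property_everywhere [consumes 4, case_names in_ideal add scale left right]:
  assumes x: "x \<in> F" "x \<notin> I" "P x" and a: "a \<in> F"
    and in_ideal: "\<And>p. p \<in> I \<Longrightarrow> P p"
    and "\<And>p q. p \<in> F \<Longrightarrow> q \<in> F \<Longrightarrow> P p \<Longrightarrow> P q \<Longrightarrow> P (p + q)"
    and "\<And>c p. p \<in> F \<Longrightarrow> P p \<Longrightarrow> P (Poly_Mapping.single 0 c * p)"
    and "\<And>b p. b \<in> F \<Longrightarrow> p \<in> F \<Longrightarrow> P p \<Longrightarrow> P (b * p)"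
    and "\<And>b p. b \<in> F \<Longrightarrow> p \<in> F \<Longrightarrow> P p \<Longrightarrow> P (p * b)"
  shows "P a"
proof -
  let ?J = "{p \<in> F. P p}"
  have 1: "alg_ideal (free_alg G) ?J"
    by (rule ideal_CollectI) (fact in_ideal[OF I_zero] assms(6-))+
  have 2: "I \<subseteq> ?J"
  proof
    fix p assume "p \<in> I"
    then show "p \<in> ?J" by (simp add: in_ideal I_subset)
  qed
  have 3: "x \<in> ?J"
    using x by simp
  have "a \<in> ?J"
    by (rule ideal_dichotomy[OF 1 2 3 x(2) a])
  then show "P a" by simp
qed

text \<open>The elements annihilating the whole algebra form an ideal, and it is not everything because some
  product is nonzero.\<close>

lemma annihilator_trivial:
  assumes x: "x \<in> F" "\<And>a. a \<in> F \<Longrightarrow> x * a \<in> I"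
  shows "x \<in> I"
proof (rule ccontr)
  assume "x \<notin> I"
  have xI: "\<forall>b\<in>F. x * b \<in> I" using x(2) by simp
  have "\<forall>b\<in>F. a * b \<in> I" if "a \<in> F" for a
    using x(1) \<open>x \<notin> I\<close> xI that
  by (induction rule: ideal_property_everywhere)
    (simp_all add: distrib_right mult.assoc mult_in_free_carrier I_add I_scale I_mult_left
      I_mult_right)
  with mult_nonzero show False by blast
qed

text \<open>The elements killed by a central element form an ideal, so a nonzero central element is not a
  zero divisor.\<close>

lemma central_cancel:
  assumes z: "central z" "z \<notin> I" and x: "x \<in> F" "z * x \<in> I"
  shows "x \<in> I"
proof (rule ccontr)
  assume "x \<notin> I"
  have zF: "z \<in> F" and za: "\<And>a. a \<in> F \<Longrightarrow> z * a \<approx> a * z"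
    using z by (auto simp: central_def)
  have "z * a \<in> I" if "a \<in> F" for a
    using x(1) \<open>x \<notin> I\<close> x(2) that
  proof (induction rule: ideal_property_everywhere)
    case (scale c p)
    then have "Poly_Mapping.single 0 c * (z * p) \<in> I" by (simp add: I_scale)
    then show ?case by (simp only: scale_left_commute)
  next
    case (left b p)
    have "z * (b * p) \<approx> b * (z * p)"
      using cong_mult_right[OF left(2) za[OF left(1)]] by (simp add: mult.assoc)
    with left show ?case
      by (simp add: cong_in_I I_mult_left)
  next
    case (right b p)
    then show ?case using I_mult_right[of b "z * p"] by (simp add: mult.assoc)
  qed (simp_all add: distrib_left I_add I_mult_left zF)
  with annihilator_trivial[OF zF] z(2) show False by simp
qed

text \<open>The eigenvectors of a central element for a fixed eigenvalue form an ideal, together with zero.\<close>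

lemma central_scalar:
  assumes z: "central z" and x: "x \<in> F" "x \<notin> I" "z * x \<approx> Poly_Mapping.single 0 c * x"
    and a: "a \<in> F"
  shows "z * a \<approx> Poly_Mapping.single 0 c * a"
proof -
  let ?S = "Poly_Mapping.single 0 c"
  have zF: "z \<in> F" and za: "\<And>a. a \<in> F \<Longrightarrow> z * a \<approx> a * z"
    using z by (auto simp: central_def)
  show ?thesis
    using x a
  proof (induction rule: ideal_property_everywhere)
    case (in_ideal p)
    then show ?case by (simp add: cong_def I_diff I_mult_left I_scale zF)
  next
    case (add p q)
    show ?case unfolding distrib_left by (rule cong_add[OF add(3,4)])
  next
    case (scale d p)
    from cong_scale[OF scale(2), of d] show ?case
      unfolding scale_left_commute[of z] scale_left_commute[of ?S] .
  next
    case (left b p)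
    have "z * (b * p) \<approx> b * (z * p)"
      using cong_mult_right[OF left(2) za[OF left(1)]] by (simp add: mult.assoc)
    also have "\<dots> \<approx> b * (?S * p)"
      using left by (simp add: cong_mult_left)
    also have "\<dots> = ?S * (b * p)"
      by (rule scale_left_commute)
    finally show ?case .
  next
    case (right b p)
    from cong_mult_right[OF right(1,3)] show ?case by (simp add: mult.assoc)
  qed
qed

end


section \<open>Gradings and central elements\<close>

definition word_deg :: "('g \<Rightarrow> 'd::ab_group_add) \<Rightarrow> 'g word \<Rightarrow> 'd" where
  "word_deg D w = sum_list (map D (letters w))"

definition homogeneous ::
  "('g \<Rightarrow> 'd::ab_group_add) \<Rightarrow> 'd \<Rightarrow> ('g word \<Rightarrow>\<^sub>0 'f::field) \<Rightarrow> bool" where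
  "homogeneous D n p \<longleftrightarrow> (\<forall>w\<in>Poly_Mapping.keys p. word_deg D w = n)"

definition component ::
  "('g \<Rightarrow> 'd::ab_group_add) \<Rightarrow> 'd \<Rightarrow> ('g word \<Rightarrow>\<^sub>0 'f::field) \<Rightarrow> 'g word \<Rightarrow>\<^sub>0 'f" where
  "component D n = Poly_Mapping.mapp (\<lambda>w c. if word_deg D w = n then c else 0)"

lemma word_deg_0 [simp]: "word_deg D 0 = 0"
  and word_deg_plus: "word_deg D (u + w) = word_deg D u + word_deg D w"
  by (simp_all add: word_deg_def zero_word_def letters_plus)

lemma lookup_component:
  "Poly_Mapping.lookup (component D n p) w = (if word_deg D w = n then Poly_Mapping.lookup p w else 0)"
  by (simp add: component_def lookup_mapp when_def in_keys_iff)

lemma component_zero [simp]: "component D n 0 = 0"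
  and component_add: "component D n (p + q) = component D n p + component D n q"
  and component_diff: "component D n (p - q) = component D n p - component D n q"
  by (rule poly_mapping_eqI; simp add: lookup_component lookup_add lookup_minus)+

lemma component_sum: "component D n (sum f X) = (\<Sum>x\<in>X. component D n (f x))"
  by (induction X rule: infinite_finite_induct) (simp_all add: component_add)

lemma component_single:
  "component D n (Poly_Mapping.single w c) = (if word_deg D w = n then Poly_Mapping.single w c else 0)"
  by (rule poly_mapping_eqI) (auto simp: lookup_component lookup_single when_def)

lemma component_homogeneous: "homogeneous D m p \<Longrightarrow> component D n p = (if n = m then p else 0)"
  by (rule poly_mapping_eqI) (auto simp: lookup_component homogeneous_def in_keys_iff)

lemma homogeneous_component: "homogeneous D n (component D n p)"
  by (auto simp: homogeneous_def in_keys_iff lookup_component split: if_splits)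

lemma homogeneous_zero [simp]: "homogeneous D n 0"
  by (simp add: homogeneous_def)

lemma homogeneous_single: "word_deg D w = n \<Longrightarrow> homogeneous D n (Poly_Mapping.single w c)"
  by (simp add: homogeneous_def)

lemma homogeneous_iff_component: "homogeneous D n p \<longleftrightarrow> component D n p = p"
  using homogeneous_component[of D n p] component_homogeneous[of D n p n] by auto

lemma homogeneous_diff: "homogeneous D n p \<Longrightarrow> homogeneous D n q \<Longrightarrow> homogeneous D n (p - q)"
  by (simp add: homogeneous_iff_component component_diff)

lemma homogeneous_sum: "(\<And>x. x \<in> X \<Longrightarrow> homogeneous D n (f x)) \<Longrightarrow> homogeneous D n (sum f X)"
  by (simp add: homogeneous_iff_component component_sum)

lemma component_eq_0:
  "n \<notin> word_deg D ` Poly_Mapping.keys p \<Longrightarrow> component D n p = 0"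
  by (rule poly_mapping_eqI) (auto simp: lookup_component in_keys_iff)

lemma sum_components: "(\<Sum>n\<in>word_deg D ` Poly_Mapping.keys p. component D n p) = p"
  by (rule poly_mapping_eqI) (auto simp: lookup_sum lookup_component in_keys_iff sum.delta')

lemma component_in_free_carrier: "p \<in> free_carrier G \<Longrightarrow> component D n p \<in> free_carrier G"
  by (auto simp: free_carrier_iff in_keys_iff lookup_component split: if_splits)

lemma component_mult_left:
  assumes "homogeneous D m h"
  shows "component D (m + n) (h * p) = h * component D n p"
proof -
  let ?h = "\<lambda>u. Poly_Mapping.single u (Poly_Mapping.lookup h u)"
    and ?p = "\<lambda>w. Poly_Mapping.single w (Poly_Mapping.lookup p w)"
  have "component D (m + n) ((\<Sum>u\<in>Poly_Mapping.keys h. ?h u) * (\<Sum>w\<in>Poly_Mapping.keys p. ?p w))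
      = (\<Sum>u\<in>Poly_Mapping.keys h. ?h u) * component D n (\<Sum>w\<in>Poly_Mapping.keys p. ?p w)"
    unfolding sum_product component_sum
    using assms by (intro sum.cong refl)
      (auto simp: mult_single component_single word_deg_plus homogeneous_def)
  then show ?thesis by (simp only: sum_monomials)
qed

lemma component_mult_right:
  assumes "homogeneous D m h"
  shows "component D (n + m) (p * h) = component D n p * h"
proof -
  let ?h = "\<lambda>u. Poly_Mapping.single u (Poly_Mapping.lookup h u)"
    and ?p = "\<lambda>w. Poly_Mapping.single w (Poly_Mapping.lookup p w)"
  have "component D (n + m) ((\<Sum>w\<in>Poly_Mapping.keys p. ?p w) * (\<Sum>u\<in>Poly_Mapping.keys h. ?h u))
      = component D n (\<Sum>w\<in>Poly_Mapping.keys p. ?p w) * (\<Sum>u\<in>Poly_Mapping.keys h. ?h u)"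
    unfolding sum_product component_sum
    using assms by (intro sum.cong refl)
      (auto simp: mult_single component_single word_deg_plus homogeneous_def)
  then show ?thesis by (simp only: sum_monomials)
qed

lemma homogeneous_mult:
  "homogeneous D m p \<Longrightarrow> homogeneous D n q \<Longrightarrow> homogeneous D (m + n) (p * q)"
  by (simp add: homogeneous_iff_component[of _ n] homogeneous_iff_component[of _ "m + n"]
      component_mult_left)

text \<open>The elements all of whose components lie in \<open>I\<close> form an ideal, so an ideal with
  homogeneous generators contains the components of its elements.\<close>

lemma genideal_component:
  fixes S :: "('g word \<Rightarrow>\<^sub>0 'f::field) set" and D :: "'g \<Rightarrow> 'd::ab_group_add"
  assumes S: "S \<subseteq> free_carrier G" and hom: "\<And>s. s \<in> S \<Longrightarrow> \<exists>n. homogeneous D n s"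
    and p: "p \<in> alg_genideal (free_alg G) S"
  shows "component D m p \<in> alg_genideal (free_alg G) S"
proof -
  define I where "I = alg_genideal (free_alg G) S"
  interpret free_alg_quot G I
    by unfold_locales (simp add: I_def genideal_ideal S)
  let ?P = "\<lambda>p. \<forall>m. component D m p \<in> I"
  have "alg_ideal (free_alg G) {p \<in> F. ?P p}"
  proof (rule ideal_CollectI)
    fix c and p :: "'g word \<Rightarrow>\<^sub>0 'f"
    assume "?P p"
    moreover have "component D m (Poly_Mapping.single 0 c * p)
        = Poly_Mapping.single 0 c * component D m p" for m
      using component_mult_left[of D 0 "Poly_Mapping.single 0 c" m p]
      by (simp add: homogeneous_single)
    ultimately show "?P (Poly_Mapping.single 0 c * p)" by (simp add: I_scale)
  next
    fix a p :: "'g word \<Rightarrow>\<^sub>0 'f"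
    assume "a \<in> F" "p \<in> F" "?P p"
    then show "?P (a * p)"
    proof (induction a rule: free_carrier_induct)
      case (monomial w c)
      have "component D m (Poly_Mapping.single w c * p)
          = Poly_Mapping.single w c * component D (m - word_deg D w) p" for m
        using component_mult_left[of D "word_deg D w" "Poly_Mapping.single w c" "m - word_deg D w" p]
        by (simp add: homogeneous_single)
      with monomial show ?case
        by (simp add: I_mult_left single_in_free_carrier)
    qed (simp_all add: distrib_right component_add I_add)
  next
    fix a p :: "'g word \<Rightarrow>\<^sub>0 'f"
    assume "a \<in> F" "p \<in> F" "?P p"
    then show "?P (p * a)"
    proof (induction a rule: free_carrier_induct)
      case (monomial w c)
      have "component D m (p * Poly_Mapping.single w c)
          = component D (m - word_deg D w) p * Poly_Mapping.single w c" for m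
        using component_mult_right[of D "word_deg D w" "Poly_Mapping.single w c" "m - word_deg D w" p]
        by (simp add: homogeneous_single)
      with monomial show ?case
        by (simp add: I_mult_right single_in_free_carrier)
    qed (simp_all add: distrib_left component_add I_add)
  qed (simp_all add: component_add I_add)
  moreover have "S \<subseteq> {p \<in> F. ?P p}"
  proof
    fix s assume s: "s \<in> S"
    obtain n where "homogeneous D n s" using hom[OF s] by (rule exE)
    moreover have "s \<in> I" unfolding I_def by (rule subsetD[OF genideal_superset s])
    ultimately show "s \<in> {p \<in> F. ?P p}"
      by (simp add: component_homogeneous I_subset)
  qed
  ultimately have "I \<subseteq> {p \<in> F. ?P p}"
    unfolding I_def by (rule genideal_least)
  moreover have "p \<in> I" unfolding I_def by (rule p)
  ultimately have "?P p" by (simp add: subset_iff)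
  then show ?thesis unfolding I_def by simp
qed

locale graded_simple_quot = simple_free_alg_quot G I
  for G :: "'g set" and I :: "('g word \<Rightarrow>\<^sub>0 'f::field) set" +
  fixes D :: "'g \<Rightarrow> int ^ 'k::finite"
  assumes component_ideal: "p \<in> I \<Longrightarrow> component D n p \<in> I"
begin

text \<open>If \<open>a\<close> is homogeneous, the components of \<open>z a - a z\<close> are, up to a shift of degrees, the
  elements \<open>z\<^sub>n a - a z\<^sub>n\<close>; and homogeneous elements span the algebra.\<close>

lemma central_component:
  assumes z: "central z"
  shows "central (component D n z)"
proof -
  have zF: "z \<in> F" and za: "\<And>a. a \<in> F \<Longrightarrow> z * a \<approx> a * z"
    using z by (auto simp: central_def)
  have "component D n z * a \<approx> a * component D n z" if "a \<in> F" for a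
    using that
  proof (induction rule: free_carrier_induct)
    case (monomial w c)
    let ?a = "Poly_Mapping.single w c"
    have h: "homogeneous D (word_deg D w) ?a" by (simp add: homogeneous_single)
    have "component D (n + word_deg D w) (z * ?a - ?a * z) \<in> I"
      using za[OF single_in_free_carrier[OF monomial]] by (intro component_ideal) (simp add: cong_def)
    then show ?case
      using component_mult_left[OF h, of n z]
      by (simp add: cong_def component_diff component_mult_right[OF h] add.commute)
  next
    case (add p q)
    from cong_add[OF add(3,4)] show ?case by (simp add: distrib_left distrib_right)
  qed simp
  then show ?thesis
    by (simp add: central_def component_in_free_carrier zF)
qed

text \<open>Suppose that \<open>z\<close> is central, nonzero and of nonzero degree \<open>n\<close>. The elements
  \<open>b - z b\<close> form an ideal, which is nonzero because \<open>v\<close> and \<open>z v\<close> lie in different degrees; so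
  \<open>v = b - z b\<close> for some \<open>b\<close>. Then the components of \<open>b\<close> satisfy \<open>b\<^sub>t = z b\<^sub>t\<^sub>-\<^sub>1\<close>
  for \<open>t \<noteq> 0\<close>, where \<open>t\<close> stands for the degree \<open>t n\<close>. Only finitely many of them are nonzero. Going
  up from very negative \<open>t\<close> gives \<open>b\<^sub>-\<^sub>1 = 0\<close>, and going down from very large \<open>t\<close>
  gives \<open>b\<^sub>0 = 0\<close>, since \<open>z\<close> is not a zero divisor. Hence \<open>v = b\<^sub>0 - z b\<^sub>-\<^sub>1 = 0\<close>.\<close>

lemma central_homogeneous_vanishes:
  assumes z: "central z" "homogeneous D n z" "n \<noteq> 0"
    and v: "v \<in> F" "v \<notin> I" "homogeneous D 0 v"
  shows "z \<in> I"
proof (rule ccontr)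
  assume "z \<notin> I"
  have zF: "z \<in> F" and za: "\<And>a. a \<in> F \<Longrightarrow> z * a \<approx> a * z"
    using z(1) by (auto simp: central_def)
  let ?P = "\<lambda>a. \<exists>b\<in>F. a \<approx> b - z * b"
  have "component D 0 (v - z * v) = v"
    using component_mult_left[OF z(2), of "- n" v] z(3) v(3)
    by (simp add: component_diff component_homogeneous[OF v(3)])
  then have 2: "v - z * v \<notin> I"
    using v(2) component_ideal[of "v - z * v" 0] by auto
  have 3: "?P (v - z * v)"
    using v(1) by (intro bexI[of _ v]) simp_all
  have 1: "v - z * v \<in> F"
    by (simp add: diff_in_free_carrier mult_in_free_carrier zF v)
  have "?P v"
    using 1 2 3 v(1)
  proof (induction rule: ideal_property_everywhere)
    case (in_ideal p)
    then show ?case by (intro bexI[of _ 0]) (simp_all add: cong_0_iff)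
  next
    case (add p q)
    then obtain b b' where b: "b \<in> F" "b' \<in> F" "p \<approx> b - z * b" "q \<approx> b' - z * b'" by blast
    have "p + q \<approx> (b + b') - z * (b + b')"
      using cong_add[OF b(3,4)] by (simp add: algebra_simps)
    with b show ?case by (intro bexI[of _ "b + b'"]) (simp_all add: add_in_free_carrier)
  next
    case (scale c p)
    then obtain b where b: "b \<in> F" "p \<approx> b - z * b" by blast
    have "Poly_Mapping.single 0 c * p \<approx> Poly_Mapping.single 0 c * (b - z * b)"
      using b(2) by (rule cong_scale)
    then have "Poly_Mapping.single 0 c * p
        \<approx> Poly_Mapping.single 0 c * b - z * (Poly_Mapping.single 0 c * b)"
      by (simp only: right_diff_distrib scale_left_commute[of z])
    with b show ?case
      by (intro bexI[of _ "Poly_Mapping.single 0 c * b"]) (simp_all add: scale_in_free_carrier)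
  next
    case (left a p)
    then obtain b where b: "b \<in> F" "p \<approx> b - z * b" by blast
    have "a * p \<approx> a * (b - z * b)"
      using left(1) b(2) by (rule cong_mult_left)
    also have "\<dots> = a * b - (a * z) * b" by (simp add: algebra_simps)
    also have "\<dots> \<approx> a * b - (z * a) * b"
      by (rule cong_diff[OF cong_refl cong_mult_right[OF b(1) cong_sym[OF za[OF left(1)]]]])
    finally have "a * p \<approx> a * b - z * (a * b)" by (simp only: mult.assoc)
    with left b show ?case by (intro bexI[of _ "a * b"]) (simp_all add: mult_in_free_carrier)
  next
    case (right a p)
    then obtain b where b: "b \<in> F" "p \<approx> b - z * b" by blast
    have "p * a \<approx> (b - z * b) * a"
      using right(1) b(2) by (rule cong_mult_right)
    then have "p * a \<approx> b * a - z * (b * a)" by (simp only: left_diff_distrib mult.assoc)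
    with right b show ?case by (intro bexI[of _ "b * a"]) (simp_all add: mult_in_free_carrier)
  qed
  then obtain b where b: "b \<in> F" "v - (b - z * b) \<in> I"
    unfolding cong_def by blast
  \<comment> \<open>Only the degrees that are multiples of \<open>n\<close> interact with \<open>v\<close>, which sits in degree \<open>0\<close>.\<close>
  define c where "c t = component D (t *s n) b" for t
  have cF: "c t \<in> F" for t
    unfolding c_def using b(1) by (rule component_in_free_carrier)
  have inj: "inj (\<lambda>t. t *s n)"
    using z(3) by (auto simp: inj_def vec_eq_iff)
  have step: "component D (t *s n) v - c t + z * c (t - 1) \<in> I" for t
  proof -
    have "t *s n = n + (t - 1) *s n"
      by (simp add: vec_eq_iff algebra_simps)
    then have "component D (t *s n) (z * b) = z * c (t - 1)"
      using component_mult_left[OF z(2), of "(t - 1) *s n" b] by (simp add: c_def)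
    then have "component D (t *s n) (v - (b - z * b))
        = component D (t *s n) v - c t + z * c (t - 1)"
      unfolding component_diff c_def[symmetric] by simp
    then show ?thesis
      using component_ideal[OF b(2), of "t *s n"] by simp
  qed
  have c_step: "c t \<approx> z * c (t - 1)" if "t \<noteq> 0" for t
  proof -
    have "t *s n \<noteq> 0"
      using injD[OF inj, of t 0] that by (auto simp: vec_eq_iff)
    then have "- (z * c (t - 1) - c t) \<in> I"
      using I_uminus[OF step[of t]] by (simp add: component_homogeneous[OF v(3)])
    then show ?thesis by (simp add: cong_def)
  qed
  define S where "S = (\<lambda>t. t *s n) -` (word_deg D ` Poly_Mapping.keys b)"
  have fin: "finite (insert 0 (abs ` S))"
    unfolding S_def using inj by (intro finite.insertI finite_imageI finite_vimageI) simp_all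
  define T where "T = Max (insert 0 (abs ` S)) + 1"
  have T: "\<bar>t\<bar> < T" if "t *s n \<in> word_deg D ` Poly_Mapping.keys b" for t
    unfolding T_def using Max_ge[OF fin, of "\<bar>t\<bar>"] that by (simp add: S_def)
  have c_out: "c t = 0" if "\<bar>t\<bar> \<ge> T" for t
  proof -
    have "t *s n \<notin> word_deg D ` Poly_Mapping.keys b"
    proof
      assume "t *s n \<in> word_deg D ` Poly_Mapping.keys b"
      from T[OF this] that show False by simp
    qed
    then show ?thesis unfolding c_def by (rule component_eq_0)
  qed
  \<comment> \<open>Upwards, multiplication by \<open>z\<close> transports zero; the implication stops the induction before the
    exceptional step from \<open>-1\<close> to \<open>0\<close>.\<close>
  have "t < 0 \<longrightarrow> c t \<in> I" if "t \<ge> - \<bar>T\<bar>" for t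
    using that
  proof (induction rule: int_ge_induct)
    case (step t)
    show ?case
    proof
      assume "t + 1 < 0"
      with step have "c t \<in> I" by simp
      then have "z * c t \<in> I" by (rule I_mult_left[OF zF])
      then show "c (t + 1) \<in> I"
        using cong_in_I[OF c_step[of "t + 1"]] \<open>t + 1 < 0\<close> by simp
    qed
  qed (simp add: c_out)
  moreover have "c t = 0" if "t < - \<bar>T\<bar>" for t
    using that by (intro c_out) simp
  ultimately have neg: "c (- 1) \<in> I"
    by (cases "- 1 < - \<bar>T\<bar>") auto
  \<comment> \<open>Downwards, \<open>z\<close> can be cancelled.\<close>
  have "t \<ge> 0 \<longrightarrow> c t \<in> I" if "t \<le> \<bar>T\<bar>" for t
    using that
  proof (induction rule: int_le_induct)
    case (step t)
    show ?case
    proof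
      assume "0 \<le> t - 1"
      with step have "c t \<in> I" by simp
      then have "z * c (t - 1) \<in> I"
        using cong_in_I[OF c_step[of t]] \<open>0 \<le> t - 1\<close> by simp
      then show "c (t - 1) \<in> I" by (rule central_cancel[OF z(1) \<open>z \<notin> I\<close> cF])
    qed
  qed (simp add: c_out)
  from this[of 0] have "c 0 \<in> I" by simp
  then have "c 0 - z * c (- 1) \<in> I"
    by (rule I_diff[OF _ I_mult_left[OF zF neg]])
  moreover have "v - c 0 + z * c (- 1) \<in> I"
    using step[of 0] component_homogeneous[OF v(3), of "0 *s n"] by (simp add: vec_eq_iff)
  ultimately have "(c 0 - z * c (- 1)) + (v - c 0 + z * c (- 1)) \<in> I"
    by (rule I_add)
  then show False
    using v(2) by simp
qed

lemma central_cong_component_0: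
  assumes z: "central z" and v: "v \<in> F" "v \<notin> I" "homogeneous D 0 v"
  shows "z \<approx> component D 0 z"
proof -
  let ?N = "word_deg D ` Poly_Mapping.keys z"
  have "z = (\<Sum>n\<in>insert 0 ?N. component D n z)"
    using sum_components[of D z] component_eq_0[of 0 D z]
    by (cases "0 \<in> ?N") (simp_all add: insert_absorb)
  also have "\<dots> \<approx> (\<Sum>n\<in>insert 0 ?N. if n = 0 then component D 0 z else 0)"
    using central_homogeneous_vanishes[OF central_component[OF z] homogeneous_component _ v]
    by (intro cong_sum) (simp add: cong_0_iff)
  also have "\<dots> = component D 0 z"
    by (simp add: sum.delta)
  finally show ?thesis .
qed

end


section \<open>The action of words on paths\<close>

context k_graph
begin

lemma factor_unique:
  assumes "\<alpha> \<in> Mor \<Lambda>" "\<delta> \<in> Mor \<Lambda>" "src \<Lambda> \<alpha> = rng \<Lambda> \<delta>"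
    and "\<alpha>' \<in> Mor \<Lambda>" "\<delta>' \<in> Mor \<Lambda>" "src \<Lambda> \<alpha>' = rng \<Lambda> \<delta>'"
    and "deg \<Lambda> \<alpha> = deg \<Lambda> \<alpha>'" "cmp \<Lambda> \<alpha> \<delta> = cmp \<Lambda> \<alpha>' \<delta>'"
  shows "\<alpha> = \<alpha>'" "\<delta> = \<delta>'"
proof -
  have "deg \<Lambda> \<alpha> + deg \<Lambda> \<delta> = deg \<Lambda> \<alpha> + deg \<Lambda> \<delta>'"
    using deg_cmp[OF assms(1-3)] deg_cmp[OF assms(4-6)] assms(7,8) by simp
  then have d: "deg \<Lambda> \<delta> = deg \<Lambda> \<delta>'" by simp
  let ?P = "\<lambda>(\<mu>, \<nu>). \<mu> \<in> Mor \<Lambda> \<and> \<nu> \<in> Mor \<Lambda> \<and> src \<Lambda> \<mu> = rng \<Lambda> \<nu> \<and>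
      deg \<Lambda> \<mu> = deg \<Lambda> \<alpha> \<and> deg \<Lambda> \<nu> = deg \<Lambda> \<delta> \<and> cmp \<Lambda> \<alpha> \<delta> = cmp \<Lambda> \<mu> \<nu>"
  have ex1: "\<exists>!x. ?P x"
    by (rule factorisation[OF cmp_closed[OF assms(1-3)] deg_cmp[OF assms(1-3)]])
  have "?P (\<alpha>, \<delta>)" "?P (\<alpha>', \<delta>')"
    using assms d by simp_all
  from this[THEN the1_equality[OF ex1]] have "(\<alpha>, \<delta>) = (\<alpha>', \<delta>')" by (rule trans[OF sym])
  then show "\<alpha> = \<alpha>'" "\<delta> = \<delta>'" by simp_all
qed

lemma factor_exists:
  assumes "l \<in> Mor \<Lambda>" "deg \<Lambda> l = m + n"
  obtains \<alpha> \<delta> where "\<alpha> \<in> Mor \<Lambda>" "\<delta> \<in> Mor \<Lambda>" "src \<Lambda> \<alpha> = rng \<Lambda> \<delta>" "deg \<Lambda> \<alpha> = m"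
    "deg \<Lambda> \<delta> = n" "l = cmp \<Lambda> \<alpha> \<delta>"
  using factorisation[OF assms] by auto

text \<open>A ghost path removes an initial segment. What can remain is collected in a set, which has at most
  one element by unique factorisation.\<close>

definition tails :: "'m \<Rightarrow> 'm \<Rightarrow> 'm set" where
  "tails \<alpha> l = {\<delta> \<in> Mor \<Lambda>. src \<Lambda> \<alpha> = rng \<Lambda> \<delta> \<and> l = cmp \<Lambda> \<alpha> \<delta>}"

text \<open>The letters of a word act one after the other, the last one first. A letter that cannot be
  applied gives \<open>None\<close>, which stands for zero.\<close>

primrec letter_act :: "'m kp_letter \<Rightarrow> 'm \<Rightarrow> 'm option" where
  "letter_act (Path \<alpha>) l = (if src \<Lambda> \<alpha> = rng \<Lambda> l then Some (cmp \<Lambda> \<alpha> l) else None)"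
| "letter_act (Ghost \<alpha>) l = (if tails \<alpha> l = {} then None else Some (the_elem (tails \<alpha> l)))"

primrec list_act :: "'m kp_letter list \<Rightarrow> 'm \<Rightarrow> 'm option" where
  "list_act [] l = Some l"
| "list_act (x # xs) l = Option.bind (list_act xs l) (letter_act x)"

lemma list_act_append: "list_act (xs @ ys) l = Option.bind (list_act ys l) (list_act xs)"
  by (induction xs) (simp_all add: bind_assoc)

lemma tails_cmp:
  assumes "\<alpha> \<in> Mor \<Lambda>" "\<delta> \<in> Mor \<Lambda>" "src \<Lambda> \<alpha> = rng \<Lambda> \<delta>"
  shows "tails \<alpha> (cmp \<Lambda> \<alpha> \<delta>) = {\<delta>}"
proof (intro equalityI subsetI)
  fix \<delta>' assume "\<delta>' \<in> tails \<alpha> (cmp \<Lambda> \<alpha> \<delta>)"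
  then have "\<delta>' \<in> Mor \<Lambda>" "src \<Lambda> \<alpha> = rng \<Lambda> \<delta>'" "cmp \<Lambda> \<alpha> \<delta> = cmp \<Lambda> \<alpha> \<delta>'"
    by (simp_all add: tails_def)
  from factor_unique(2)[OF assms assms(1) this(1,2) refl this(3)] show "\<delta>' \<in> {\<delta>}" by simp
qed (simp add: tails_def assms)

lemma ghost_act_iff:
  assumes "\<alpha> \<in> Mor \<Lambda>"
  shows "letter_act (Ghost \<alpha>) l = Some \<delta> \<longleftrightarrow> \<delta> \<in> tails \<alpha> l"
proof (cases "tails \<alpha> l = {}")
  case False
  then obtain \<delta>' where "\<delta>' \<in> tails \<alpha> l" by blast
  then have "tails \<alpha> l = {\<delta>'}"
    using tails_cmp[OF assms, of \<delta>'] by (simp add: tails_def)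
  then show ?thesis by auto
qed simp

declare letter_act.simps(2) [simp del]

text \<open>The weight counts every letter positively. A path whose degree is at least the weight of a word
  remains long enough, at each stage, for the ghost path to be applied next.\<close>

primrec letter_weight :: "'m kp_letter \<Rightarrow> nat ^ 'k" where
  "letter_weight (Path l) = deg \<Lambda> l"
| "letter_weight (Ghost l) = deg \<Lambda> l"

abbreviation weight :: "'m kp_letter list \<Rightarrow> nat ^ 'k" where
  "weight xs \<equiv> sum_list (map letter_weight xs)"

text \<open>The grading for which all defining relations are homogeneous.\<close>

primrec letter_deg :: "'m kp_letter \<Rightarrow> int ^ 'k" where
  "letter_deg (Path l) = (\<chi> i. int (deg \<Lambda> l $ i))"
| "letter_deg (Ghost l) = - (\<chi> i. int (deg \<Lambda> l $ i))"

lemma letter_act_Some: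
  assumes "x \<in> kp_letters \<Lambda>" "l \<in> Mor \<Lambda>" "letter_act x l = Some \<mu>"
  shows "\<mu> \<in> Mor \<Lambda>" "src \<Lambda> \<mu> = src \<Lambda> l"
    and "letter_deg (Path \<mu>) = letter_deg x + letter_deg (Path l)"
    and "deg \<Lambda> l = letter_weight x + n \<Longrightarrow> \<exists>r. deg \<Lambda> \<mu> = n + r"
proof -
  have "\<mu> \<in> Mor \<Lambda> \<and> src \<Lambda> \<mu> = src \<Lambda> l \<and> letter_deg (Path \<mu>) = letter_deg x + letter_deg (Path l)
    \<and> (deg \<Lambda> l = letter_weight x + n \<longrightarrow> (\<exists>r. deg \<Lambda> \<mu> = n + r))"
  proof (cases x)
    case (Path \<alpha>)
    then have \<alpha>: "\<alpha> \<in> Mor \<Lambda>" "src \<Lambda> \<alpha> = rng \<Lambda> l" "\<mu> = cmp \<Lambda> \<alpha> l"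
      using assms by (auto simp: kp_letters_def split: if_splits)
    have "deg \<Lambda> \<mu> = n + (deg \<Lambda> \<alpha> + deg \<Lambda> \<alpha>)" if "deg \<Lambda> l = deg \<Lambda> \<alpha> + n"
      using that \<alpha> assms(2) by (simp add: deg_cmp algebra_simps)
    moreover have "letter_deg (Path \<mu>) = letter_deg x + letter_deg (Path l)"
      using \<alpha> assms(2) Path by (simp add: deg_cmp vec_eq_iff)
    ultimately show ?thesis
      using \<alpha> assms(2) Path by (auto simp: cmp_closed src_cmp)
  next
    case (Ghost \<alpha>)
    then have \<alpha>: "\<alpha> \<in> Mor \<Lambda>" using assms(1) by (auto simp: kp_letters_def)
    with assms(3) Ghost have "\<mu> \<in> tails \<alpha> l" by (simp add: ghost_act_iff)
    then have \<mu>: "\<mu> \<in> Mor \<Lambda>" "src \<Lambda> \<alpha> = rng \<Lambda> \<mu>" "l = cmp \<Lambda> \<alpha> \<mu>"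
      by (simp_all add: tails_def)
    have "deg \<Lambda> \<mu> = n + 0" if "deg \<Lambda> l = deg \<Lambda> \<alpha> + n"
      using that \<alpha> \<mu> by (simp add: deg_cmp)
    moreover have "letter_deg (Path \<mu>) = letter_deg x + letter_deg (Path l)"
      using \<alpha> \<mu> Ghost by (simp add: deg_cmp vec_eq_iff)
    moreover have "src \<Lambda> \<mu> = src \<Lambda> l"
      using \<alpha> \<mu> by (simp add: src_cmp)
    ultimately show ?thesis
      using \<mu>(1) Ghost by (simp only: letter_weight.simps) blast
  qed
  then show "\<mu> \<in> Mor \<Lambda>" "src \<Lambda> \<mu> = src \<Lambda> l"
    "letter_deg (Path \<mu>) = letter_deg x + letter_deg (Path l)"
    "deg \<Lambda> l = letter_weight x + n \<Longrightarrow> \<exists>r. deg \<Lambda> \<mu> = n + r"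
    by blast+
qed

lemma list_act_Some:
  assumes "set xs \<subseteq> kp_letters \<Lambda>" "l \<in> Mor \<Lambda>" "list_act xs l = Some \<mu>"
  shows "\<mu> \<in> Mor \<Lambda> \<and> src \<Lambda> \<mu> = src \<Lambda> l
    \<and> letter_deg (Path \<mu>) = sum_list (map letter_deg xs) + letter_deg (Path l)"
  using assms
proof (induction xs arbitrary: \<mu>)
  case (Cons x xs)
  then obtain \<nu> where \<nu>: "list_act xs l = Some \<nu>" "letter_act x \<nu> = Some \<mu>"
    by (auto simp: bind_eq_Some_conv)
  with Cons have "\<nu> \<in> Mor \<Lambda>" "src \<Lambda> \<nu> = src \<Lambda> l"
    "letter_deg (Path \<nu>) = sum_list (map letter_deg xs) + letter_deg (Path l)" "x \<in> kp_letters \<Lambda>"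
    by auto
  with letter_act_Some(1-3)[OF this(4) this(1) \<nu>(2)] show ?case
    by (simp add: add.assoc)
qed simp

lemma list_act_deg:
  assumes "set xs \<subseteq> kp_letters \<Lambda>" "l \<in> Mor \<Lambda>" "list_act xs l = Some \<mu>"
    and "deg \<Lambda> l = weight xs + n"
  shows "\<exists>r. deg \<Lambda> \<mu> = n + r"
  using assms
proof (induction xs arbitrary: \<mu> n)
  case Nil
  then show ?case by (auto intro: exI[of _ 0])
next
  case (Cons x xs)
  then obtain \<nu> where \<nu>: "list_act xs l = Some \<nu>" "letter_act x \<nu> = Some \<mu>"
    by (auto simp: bind_eq_Some_conv)
  have x: "x \<in> kp_letters \<Lambda>" and xs: "set xs \<subseteq> kp_letters \<Lambda>"
    using Cons.prems(1) by simp_all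
  have "deg \<Lambda> l = weight xs + (letter_weight x + n)"
    using Cons.prems(4) by (simp add: algebra_simps)
  from Cons.IH[OF xs Cons.prems(2) \<nu>(1) this] obtain r
    where r: "deg \<Lambda> \<nu> = letter_weight x + (n + r)" by (auto simp: add.assoc)
  have "\<nu> \<in> Mor \<Lambda>" using list_act_Some[OF xs Cons.prems(2) \<nu>(1)] by simp
  from letter_act_Some(4)[OF x this \<nu>(2) r] show ?case by (auto simp: add.assoc)
qed

text \<open>To express that an element \<open>p\<close> kills the path \<open>l\<close>, functionals \<open>g\<close> on the space spanned by the
  paths are evaluated at \<open>p l\<close>. Multiplying \<open>p\<close> from the left by a word then amounts to changing \<open>g\<close>,
  and multiplying it from the right amounts to changing \<open>l\<close>.\<close>

definition opt_app :: "('m \<Rightarrow> 'f) \<Rightarrow> 'm option \<Rightarrow> 'f::field" where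
  "opt_app g o' = (case o' of None \<Rightarrow> 0 | Some l \<Rightarrow> g l)"

lemma opt_app_simps [simp]: "opt_app g None = 0" "opt_app g (Some l) = g l"
  by (simp_all add: opt_app_def)

lemma opt_app_bind: "opt_app g (Option.bind o' h) = opt_app (\<lambda>l. opt_app g (h l)) o'"
  by (cases o') simp_all

definition act_eval :: "('m \<Rightarrow> 'f) \<Rightarrow> 'm \<Rightarrow> ('m kp_letter word \<Rightarrow>\<^sub>0 'f::field) \<Rightarrow> 'f" where
  "act_eval g l p =
     (\<Sum>w\<in>Poly_Mapping.keys p. Poly_Mapping.lookup p w * opt_app g (list_act (letters w) l))"

lemma act_eval_0 [simp]: "act_eval g l 0 = 0"
  by (simp add: act_eval_def)

lemma act_eval_add: "act_eval g l (p + q) = act_eval g l p + act_eval g l q"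
  unfolding act_eval_def by (rule setsum_keys_plus_distrib) (simp_all add: distrib_right)

lemma act_eval_single:
  "act_eval g l (Poly_Mapping.single w c) = c * opt_app g (list_act (letters w) l)"
  by (simp add: act_eval_def)

lemma act_eval_diff: "act_eval g l (p - q) = act_eval g l p - act_eval g l q"
  using act_eval_add[of g l "p - q" q] by simp

lemma act_eval_sum: "act_eval g l (sum f X) = (\<Sum>x\<in>X. act_eval g l (f x))"
  by (induction X rule: infinite_finite_induct) (simp_all add: act_eval_add)

lemma act_eval_mult_left:
  "act_eval g l (Poly_Mapping.single u c * p)
     = c * act_eval (\<lambda>l. opt_app g (list_act (letters u) l)) l p"
proof -
  have "act_eval g l (Poly_Mapping.single u c
        * (\<Sum>w\<in>Poly_Mapping.keys p. Poly_Mapping.single w (Poly_Mapping.lookup p w)))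
      = c * act_eval (\<lambda>l. opt_app g (list_act (letters u) l)) l
        (\<Sum>w\<in>Poly_Mapping.keys p. Poly_Mapping.single w (Poly_Mapping.lookup p w))"
    by (simp add: sum_distrib_left mult_single act_eval_sum act_eval_single letters_plus
        list_act_append opt_app_bind mult.assoc)
  then show ?thesis by (simp only: sum_monomials)
qed

lemma act_eval_mult_right:
  "act_eval g l (p * Poly_Mapping.single u c)
     = c * opt_app (\<lambda>\<mu>. act_eval g \<mu> p) (list_act (letters u) l)"
proof -
  have "act_eval g l ((\<Sum>w\<in>Poly_Mapping.keys p. Poly_Mapping.single w (Poly_Mapping.lookup p w))
        * Poly_Mapping.single u c)
      = c * opt_app (\<lambda>\<mu>. act_eval g \<mu>
        (\<Sum>w\<in>Poly_Mapping.keys p. Poly_Mapping.single w (Poly_Mapping.lookup p w)))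
          (list_act (letters u) l)"
    by (cases "list_act (letters u) l")
      (simp_all add: sum_distrib_left sum_distrib_right mult_single act_eval_sum act_eval_single
        letters_plus list_act_append ac_simps)
  then show ?thesis by (simp only: sum_monomials)
qed

text \<open>Here \<open>l\<close> is large if its degree is of the form \<open>N + m\<close>, that is, at least \<open>N\<close> in every
  coordinate.\<close>

definition kills_large_paths :: "('m kp_letter word \<Rightarrow>\<^sub>0 'f::field) \<Rightarrow> bool" where
  "kills_large_paths p \<longleftrightarrow>
     (\<exists>N. \<forall>l\<in>Mor \<Lambda>. \<forall>m. deg \<Lambda> l = N + m \<longrightarrow> (\<forall>g. act_eval g l p = 0))"

lemma kills_large_pathsI:
  "(\<And>l m g. l \<in> Mor \<Lambda> \<Longrightarrow> deg \<Lambda> l = N + m \<Longrightarrow> act_eval g l p = 0) \<Longrightarrow> kills_large_paths p"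
  unfolding kills_large_paths_def by blast

lemma kills_large_paths_add:
  fixes p q :: "'m kp_letter word \<Rightarrow>\<^sub>0 'f::field"
  assumes "kills_large_paths p" "kills_large_paths q"
  shows "kills_large_paths (p + q)"
proof -
  from assms obtain M N where
    M: "\<And>l m g. l \<in> Mor \<Lambda> \<Longrightarrow> deg \<Lambda> l = M + m \<Longrightarrow> act_eval g l p = 0" and
    N: "\<And>l m g. l \<in> Mor \<Lambda> \<Longrightarrow> deg \<Lambda> l = N + m \<Longrightarrow> act_eval g l q = 0"
    unfolding kills_large_paths_def by metis
  show ?thesis
  proof (rule kills_large_pathsI)
    fix l m and g :: "'m \<Rightarrow> 'f"
    assume l: "l \<in> Mor \<Lambda>" "deg \<Lambda> l = M + N + m"
    have "deg \<Lambda> l = M + (N + m)" "deg \<Lambda> l = N + (M + m)"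
      using l(2) by (simp_all add: algebra_simps)
    from M[OF l(1) this(1)] N[OF l(1) this(2)] show "act_eval g l (p + q) = 0"
      by (simp add: act_eval_add)
  qed
qed

text \<open>Multiplication from the right is harmless because a word \<open>w\<close> lowers the degree of a path by at
  most its weight, so that it sends large paths to large paths.\<close>

lemma kills_large_paths_ideal:
  "alg_ideal (free_alg (kp_letters \<Lambda>))
     {p \<in> free_carrier (kp_letters \<Lambda>). kills_large_paths (p :: _ \<Rightarrow>\<^sub>0 'f::field)}"
proof (rule ideal_CollectI)
  show "kills_large_paths (0 :: _ \<Rightarrow>\<^sub>0 'f)"
    by (rule kills_large_pathsI) simp
  show "kills_large_paths (p + q)" if "kills_large_paths p" "kills_large_paths q"
    for p q :: "_ \<Rightarrow>\<^sub>0 'f"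
    using that by (rule kills_large_paths_add)
  have left: "kills_large_paths (Poly_Mapping.single u c * p)" if "kills_large_paths p"
    for u c and p :: "_ \<Rightarrow>\<^sub>0 'f"
    using that unfolding kills_large_paths_def act_eval_mult_left by (metis mult_zero_right)
  show "kills_large_paths (Poly_Mapping.single 0 c * p)" if "kills_large_paths p"
    for c and p :: "_ \<Rightarrow>\<^sub>0 'f"
    using that by (rule left)
  show "kills_large_paths (a * p)"
    if "a \<in> free_carrier (kp_letters \<Lambda>)" "kills_large_paths p" for a p :: "_ \<Rightarrow>\<^sub>0 'f"
    using that
  proof (induction rule: free_carrier_induct)
    case zero
    show ?case by (rule kills_large_pathsI) simp
  next
    case (monomial w c)
    then show ?case by (simp add: left)
  next
    case (add a b)
    then show ?case by (simp add: distrib_right kills_large_paths_add)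
  qed
  show "kills_large_paths (p * a)"
    if "a \<in> free_carrier (kp_letters \<Lambda>)" "kills_large_paths p" for a p :: "_ \<Rightarrow>\<^sub>0 'f"
    using that
  proof (induction rule: free_carrier_induct)
    case zero
    show ?case by (rule kills_large_pathsI) simp
  next
    case (monomial w c)
    then obtain N where
      N: "\<And>l m g. l \<in> Mor \<Lambda> \<Longrightarrow> deg \<Lambda> l = N + m \<Longrightarrow> act_eval g l p = 0"
      unfolding kills_large_paths_def by metis
    show ?case
    proof (rule kills_large_pathsI)
      fix l m and g :: "'m \<Rightarrow> 'f"
      assume l: "l \<in> Mor \<Lambda>" "deg \<Lambda> l = weight (letters w) + N + m"
      show "act_eval g l (p * Poly_Mapping.single w c) = 0"
      proof (cases "list_act (letters w) l")
        case (Some \<mu>)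
        have "deg \<Lambda> l = weight (letters w) + (N + m)" using l(2) by (simp add: add.assoc)
        from list_act_deg[OF monomial(2) l(1) Some this] obtain r
          where "deg \<Lambda> \<mu> = N + (m + r)" by (auto simp: add.assoc)
        moreover have "\<mu> \<in> Mor \<Lambda>" using list_act_Some[OF monomial(2) l(1) Some] by simp
        ultimately show ?thesis using N Some by (simp add: act_eval_mult_right)
      qed (simp add: act_eval_mult_right)
    qed
  next
    case (add a b)
    then show ?case by (simp add: distrib_left kills_large_paths_add)
  qed
qed

end


section \<open>The defining relations and the nonvanishing of vertices\<close>

abbreviation kp_relators :: "('o, 'm, 'k::finite) kgraph \<Rightarrow> ('m kp_letter word \<Rightarrow>\<^sub>0 'f::field) set" where
  "kp_relators \<Lambda> \<equiv> kp0 \<Lambda> \<union> kp1 \<Lambda> \<union> kp2 \<Lambda> \<union> kp3 \<Lambda> \<union> kp4 \<Lambda>"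

lemma word_append: "Word xs + Word ys = Word (xs @ ys)"
  by (simp add: plus_word_def)

context k_graph
begin

lemma path_carrier: "l \<in> Mor \<Lambda> \<Longrightarrow> kp_path l \<in> free_carrier (kp_letters \<Lambda>)"
  and ghost_carrier: "l \<in> Mor \<Lambda> \<Longrightarrow> kp_ghost l \<in> free_carrier (kp_letters \<Lambda>)"
  by (rule letter_in_free_carrier, simp add: kp_letters_def)+

lemma kp_relators_subset: "kp_relators \<Lambda> \<subseteq> free_carrier (kp_letters \<Lambda>)"
proof -
  have "x \<in> free_carrier (kp_letters \<Lambda>)" if "x \<in> kp0 \<Lambda>" for x
    using that by (auto simp: kp0_def intro!: diff_in_free_carrier path_carrier ghost_carrier idm_closed)
  moreover have "x \<in> free_carrier (kp_letters \<Lambda>)" if "x \<in> kp1 \<Lambda>" for x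
    using that unfolding kp1_def
    by (auto simp del: mult_single simp: idm_closed
        intro!: diff_in_free_carrier mult_in_free_carrier path_carrier ghost_carrier)
  moreover have "x \<in> free_carrier (kp_letters \<Lambda>)" if "x \<in> kp2 \<Lambda>" for x
    using that unfolding kp2_def
    by (auto simp: cmp_closed
        intro!: diff_in_free_carrier mult_in_free_carrier path_carrier ghost_carrier)
  moreover have "x \<in> free_carrier (kp_letters \<Lambda>)" if "x \<in> kp3 \<Lambda>" for x
    using that unfolding kp3_def
    by (auto simp: idm_closed src_closed
        intro!: diff_in_free_carrier mult_in_free_carrier path_carrier ghost_carrier)
  moreover have "x \<in> free_carrier (kp_letters \<Lambda>)" if "x \<in> kp4 \<Lambda>" for x
    using that unfolding kp4_def
    by (auto simp: idm_closed paths_to_def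
        intro!: diff_in_free_carrier sum_in_free_carrier mult_in_free_carrier path_carrier ghost_carrier)
  ultimately show ?thesis by blast
qed

lemma homogeneous_path: "homogeneous letter_deg (letter_deg (Path l)) (kp_path l)"
  and homogeneous_ghost: "homogeneous letter_deg (- letter_deg (Path l)) (kp_ghost l)"
  by (simp_all add: homogeneous_def word_deg_def)

lemma letter_deg_idm: "v \<in> Obj \<Lambda> \<Longrightarrow> letter_deg (Path (idm \<Lambda> v)) = 0"
  by (simp add: deg_idm vec_eq_iff)

lemma homogeneous_idm:
  assumes "v \<in> Obj \<Lambda>"
  shows "homogeneous letter_deg 0 (kp_path (idm \<Lambda> v))"
  using homogeneous_path[of "idm \<Lambda> v"] unfolding letter_deg_idm[OF assms] .

lemma letter_deg_cmp:
  "l \<in> Mor \<Lambda> \<Longrightarrow> m \<in> Mor \<Lambda> \<Longrightarrow> src \<Lambda> l = rng \<Lambda> m \<Longrightarrow>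
    letter_deg (Path (cmp \<Lambda> l m)) = letter_deg (Path l) + letter_deg (Path m)"
  by (simp add: deg_cmp vec_eq_iff)

lemma kp_relators_homogeneous:
  assumes "x \<in> kp_relators \<Lambda>"
  shows "\<exists>n. homogeneous letter_deg n x"
proof -
  consider "x \<in> kp0 \<Lambda>" | "x \<in> kp1 \<Lambda>" | "x \<in> kp2 \<Lambda>" | "x \<in> kp3 \<Lambda>" | "x \<in> kp4 \<Lambda>"
    using assms by blast
  then show ?thesis
  proof cases
    case 1
    then obtain v where v: "v \<in> Obj \<Lambda>" "x = kp_ghost (idm \<Lambda> v) - kp_path (idm \<Lambda> v)"
      unfolding kp0_def by blast
    have "homogeneous letter_deg 0 x"
      unfolding v(2) using homogeneous_ghost[of "idm \<Lambda> v"] homogeneous_idm[OF v(1)]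
      by (intro homogeneous_diff) (simp_all only: letter_deg_idm[OF v(1)] minus_zero)
    then show ?thesis ..
  next
    case 2
    then obtain v w where v: "v \<in> Obj \<Lambda>" "w \<in> Obj \<Lambda>"
      "x = kp_path (idm \<Lambda> v) * kp_path (idm \<Lambda> w) - (if v = w then kp_path (idm \<Lambda> w) else 0)"
      unfolding kp1_def by blast
    have "homogeneous letter_deg 0 x"
      unfolding v(3)
      using homogeneous_mult[OF homogeneous_idm[OF v(1)] homogeneous_idm[OF v(2)]]
      by (intro homogeneous_diff) (simp_all add: homogeneous_idm[OF v(2)])
    then show ?thesis ..
  next
    case 3
    then consider
        l m where "l \<in> Mor \<Lambda>" "m \<in> Mor \<Lambda>" "src \<Lambda> l = rng \<Lambda> m"
          "x = kp_path l * kp_path m - kp_path (cmp \<Lambda> l m)"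
      | l m where "l \<in> Mor \<Lambda>" "m \<in> Mor \<Lambda>" "src \<Lambda> l = rng \<Lambda> m"
          "x = kp_ghost m * kp_ghost l - kp_ghost (cmp \<Lambda> l m)"
      unfolding kp2_def by (smt (verit, best) UnE mem_Collect_eq)
    then show ?thesis
    proof cases
      case 1
      have "homogeneous letter_deg (letter_deg (Path l) + letter_deg (Path m)) x"
        unfolding 1(4) using homogeneous_path[of "cmp \<Lambda> l m"]
        unfolding letter_deg_cmp[OF 1(1-3)]
        by (intro homogeneous_diff homogeneous_mult homogeneous_path)
      then show ?thesis ..
    next
      case 2
      have "homogeneous letter_deg (- letter_deg (Path m) + - letter_deg (Path l)) x"
        unfolding 2(4) using homogeneous_ghost[of "cmp \<Lambda> l m"]
        unfolding letter_deg_cmp[OF 2(1-3)] minus_add_distrib add.commute[of "- letter_deg (Path l)"]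
        by (intro homogeneous_diff homogeneous_mult homogeneous_ghost)
      then show ?thesis ..
    qed
  next
    case 4
    then obtain l m where lm: "l \<in> Mor \<Lambda>" "m \<in> Mor \<Lambda>" "deg \<Lambda> l = deg \<Lambda> m"
      "x = kp_ghost l * kp_path m - (if l = m then kp_path (idm \<Lambda> (src \<Lambda> l)) else 0)"
      unfolding kp3_def by blast
    have "- letter_deg (Path l) + letter_deg (Path m) = 0"
      by (simp add: lm(3))
    then have "homogeneous letter_deg 0 x"
      unfolding lm(4)
      using homogeneous_mult[OF homogeneous_ghost[of l] homogeneous_path[of m]]
        homogeneous_idm[OF src_closed[OF lm(1)]]
      by (intro homogeneous_diff) (auto split: if_splits)
    then show ?thesis ..
  next
    case 5
    then obtain v n where v: "v \<in> Obj \<Lambda>"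
      "x = kp_path (idm \<Lambda> v) - (\<Sum>l \<in> paths_to \<Lambda> v n. kp_path l * kp_ghost l)"
      unfolding kp4_def by blast
    have "homogeneous letter_deg 0 (kp_path l * kp_ghost l)" for l
      using homogeneous_mult[OF homogeneous_path[of l] homogeneous_ghost[of l]] by simp
    then have "homogeneous letter_deg 0 x"
      unfolding v(2) by (intro homogeneous_diff homogeneous_sum homogeneous_idm v(1))
    then show ?thesis ..
  qed
qed

lemma path_act_idm:
  "v \<in> Obj \<Lambda> \<Longrightarrow> l \<in> Mor \<Lambda> \<Longrightarrow>
    letter_act (Path (idm \<Lambda> v)) l = (if rng \<Lambda> l = v then Some l else None)"
  using cmp_idm_left[of l] by (auto simp: src_idm)

lemma ghost_act_cmp:
  assumes "\<alpha> \<in> Mor \<Lambda>" "\<gamma> \<in> Mor \<Lambda>" "\<delta> \<in> Mor \<Lambda>" "src \<Lambda> \<gamma> = rng \<Lambda> \<delta>" "deg \<Lambda> \<gamma> = deg \<Lambda> \<alpha>"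
  shows "letter_act (Ghost \<alpha>) (cmp \<Lambda> \<gamma> \<delta>) = (if \<alpha> = \<gamma> then Some \<delta> else None)"
proof (cases "\<alpha> = \<gamma>")
  case True
  then show ?thesis using assms by (simp add: ghost_act_iff tails_cmp)
next
  case False
  have "tails \<alpha> (cmp \<Lambda> \<gamma> \<delta>) = {}"
  proof (rule ccontr)
    assume "tails \<alpha> (cmp \<Lambda> \<gamma> \<delta>) \<noteq> {}"
    then obtain \<delta>' where \<delta>': "\<delta>' \<in> tails \<alpha> (cmp \<Lambda> \<gamma> \<delta>)" by blast
    then have d: "\<delta>' \<in> Mor \<Lambda>" "src \<Lambda> \<alpha> = rng \<Lambda> \<delta>'" "cmp \<Lambda> \<gamma> \<delta> = cmp \<Lambda> \<alpha> \<delta>'"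
      by (simp_all add: tails_def)
    from factor_unique(1)[OF assms(2-4,1) d(1,2) assms(5) d(3)] False show False by simp
  qed
  with False show ?thesis by (simp add: letter_act.simps)
qed

lemma ghost_act_idm:
  assumes "v \<in> Obj \<Lambda>" "l \<in> Mor \<Lambda>"
  shows "letter_act (Ghost (idm \<Lambda> v)) l = (if rng \<Lambda> l = v then Some l else None)"
proof -
  have r: "rng \<Lambda> l \<in> Obj \<Lambda>" by (rule rng_closed[OF assms(2)])
  have "letter_act (Ghost (idm \<Lambda> v)) (cmp \<Lambda> (idm \<Lambda> (rng \<Lambda> l)) l)
      = (if idm \<Lambda> v = idm \<Lambda> (rng \<Lambda> l) then Some l else None)"
    by (rule ghost_act_cmp) (simp_all only: idm_closed src_idm deg_idm assms r)
  moreover have "idm \<Lambda> v = idm \<Lambda> (rng \<Lambda> l) \<longleftrightarrow> rng \<Lambda> l = v"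
    using rng_idm[OF assms(1)] rng_idm[OF r] by metis
  ultimately show ?thesis by (simp only: cmp_idm_left[OF assms(2)])
qed

lemma act_eval_letter: "act_eval g l (Poly_Mapping.single (Word [x]) 1) = opt_app g (letter_act x l)"
  by (simp add: act_eval_single)

lemma act_eval_letter2:
  "act_eval g l (Poly_Mapping.single (Word [x]) 1 * Poly_Mapping.single (Word [y]) 1)
    = opt_app g (Option.bind (letter_act y l) (letter_act x))"
  by (simp add: act_eval_single mult_single word_append)

lemma path_act_cmp:
  assumes "l \<in> Mor \<Lambda>" "m \<in> Mor \<Lambda>" "src \<Lambda> l = rng \<Lambda> m" "\<xi> \<in> Mor \<Lambda>"
  shows "Option.bind (letter_act (Path m) \<xi>) (letter_act (Path l)) = letter_act (Path (cmp \<Lambda> l m)) \<xi>"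
  using assms by (auto simp: src_cmp rng_cmp cmp_assoc)

lemma ghost_act_ghost:
  assumes "l \<in> Mor \<Lambda>" "m \<in> Mor \<Lambda>" "src \<Lambda> l = rng \<Lambda> m"
  shows "Option.bind (letter_act (Ghost l) \<xi>) (letter_act (Ghost m))
    = letter_act (Ghost (cmp \<Lambda> l m)) \<xi>"
proof -
  have "Option.bind (letter_act (Ghost l) \<xi>) (letter_act (Ghost m)) = Some \<delta>
      \<longleftrightarrow> letter_act (Ghost (cmp \<Lambda> l m)) \<xi> = Some \<delta>" for \<delta>
  proof -
    have "Option.bind (letter_act (Ghost l) \<xi>) (letter_act (Ghost m)) = Some \<delta>
        \<longleftrightarrow> (\<exists>\<eta>\<in>tails l \<xi>. \<delta> \<in> tails m \<eta>)"
      by (simp only: bind_eq_Some_conv ghost_act_iff[OF assms(1)] ghost_act_iff[OF assms(2)] Bex_def)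
    also have "\<dots> \<longleftrightarrow> \<delta> \<in> tails (cmp \<Lambda> l m) \<xi>"
    proof
      assume "\<exists>\<eta>\<in>tails l \<xi>. \<delta> \<in> tails m \<eta>"
      then obtain \<eta> where "\<xi> = cmp \<Lambda> l \<eta>" "\<delta> \<in> Mor \<Lambda>" "src \<Lambda> m = rng \<Lambda> \<delta>" "\<eta> = cmp \<Lambda> m \<delta>"
        by (auto simp: tails_def)
      then show "\<delta> \<in> tails (cmp \<Lambda> l m) \<xi>"
        using assms by (simp add: tails_def src_cmp cmp_assoc)
    next
      assume "\<delta> \<in> tails (cmp \<Lambda> l m) \<xi>"
      then have \<delta>: "\<delta> \<in> Mor \<Lambda>" "src \<Lambda> m = rng \<Lambda> \<delta>" "\<xi> = cmp \<Lambda> (cmp \<Lambda> l m) \<delta>"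
        using assms by (simp_all add: tails_def src_cmp)
      show "\<exists>\<eta>\<in>tails l \<xi>. \<delta> \<in> tails m \<eta>"
      proof
        show "cmp \<Lambda> m \<delta> \<in> tails l \<xi>" "\<delta> \<in> tails m (cmp \<Lambda> m \<delta>)"
          using assms \<delta> by (simp_all add: tails_def cmp_closed rng_cmp cmp_assoc)
      qed
    qed
    finally show ?thesis using assms by (simp add: ghost_act_iff cmp_closed)
  qed
  then show ?thesis by (metis not_None_eq)
qed

text \<open>The relation \<open>v = \<Sum> l l\<^sup>*\<close> over the paths \<open>l\<close> of degree \<open>n\<close> with range \<open>v\<close> holds only on
  paths that have an initial segment of degree \<open>n\<close>; this is why the action is considered on
  large paths.\<close>

lemma kp_relators_kill_large_paths:
  fixes x :: "'m kp_letter word \<Rightarrow>\<^sub>0 'f::field"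
  assumes row_finite: "row_finite \<Lambda>" and "x \<in> kp_relators \<Lambda>"
  shows "kills_large_paths x"
proof -
  consider "x \<in> kp0 \<Lambda>" | "x \<in> kp1 \<Lambda>" | "x \<in> kp2 \<Lambda>" | "x \<in> kp3 \<Lambda>" | "x \<in> kp4 \<Lambda>"
    using assms by blast
  then show ?thesis
  proof cases
    case 1
    then obtain v where v: "v \<in> Obj \<Lambda>" "x = kp_ghost (idm \<Lambda> v) - kp_path (idm \<Lambda> v)"
      unfolding kp0_def by blast
    show ?thesis
      by (rule kills_large_pathsI)
        (simp only: v(2) act_eval_diff act_eval_letter path_act_idm[OF v(1)] ghost_act_idm[OF v(1)]
          diff_self)
  next
    case 2
    then obtain v w where v: "v \<in> Obj \<Lambda>" "w \<in> Obj \<Lambda>"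
      "x = kp_path (idm \<Lambda> v) * kp_path (idm \<Lambda> w) - (if v = w then kp_path (idm \<Lambda> w) else 0)"
      unfolding kp1_def by blast
    show ?thesis
    proof (rule kills_large_pathsI)
      fix l m g
      assume l: "l \<in> Mor \<Lambda>"
      show "act_eval g l x = 0"
        unfolding v(3) act_eval_diff act_eval_letter2 path_act_idm[OF v(2) l]
        by (cases "v = w"; cases "rng \<Lambda> l = w")
          (simp_all add: act_eval_letter path_act_idm v(1,2) l del: letter_act.simps)
    qed
  next
    case 3
    then consider
        l m where "l \<in> Mor \<Lambda>" "m \<in> Mor \<Lambda>" "src \<Lambda> l = rng \<Lambda> m"
          "x = kp_path l * kp_path m - kp_path (cmp \<Lambda> l m)"
      | l m where "l \<in> Mor \<Lambda>" "m \<in> Mor \<Lambda>" "src \<Lambda> l = rng \<Lambda> m"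
          "x = kp_ghost m * kp_ghost l - kp_ghost (cmp \<Lambda> l m)"
      unfolding kp2_def by (smt (verit, best) UnE mem_Collect_eq)
    then show ?thesis
    proof cases
      case 1
      show ?thesis
        by (rule kills_large_pathsI)
          (simp only: 1(4) act_eval_diff act_eval_letter act_eval_letter2 path_act_cmp[OF 1(1-3)]
            diff_self)
    next
      case 2
      show ?thesis
        by (rule kills_large_pathsI)
          (simp only: 2(4) act_eval_diff act_eval_letter act_eval_letter2 ghost_act_ghost[OF 2(1-3)]
            diff_self)
    qed
  next
    case 4
    then obtain l m where lm: "l \<in> Mor \<Lambda>" "m \<in> Mor \<Lambda>" "deg \<Lambda> l = deg \<Lambda> m"
      "x = kp_ghost l * kp_path m - (if l = m then kp_path (idm \<Lambda> (src \<Lambda> l)) else 0)"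
      unfolding kp3_def by blast
    show ?thesis
    proof (rule kills_large_pathsI)
      fix \<xi> n g
      assume \<xi>: "\<xi> \<in> Mor \<Lambda>"
      have "Option.bind (letter_act (Path m) \<xi>) (letter_act (Ghost l))
          = (if l = m \<and> rng \<Lambda> \<xi> = src \<Lambda> l then Some \<xi> else None)"
        using ghost_act_cmp[OF lm(1,2) \<xi> _ lm(3)[symmetric]] by auto
      then show "act_eval g \<xi> x = 0"
        unfolding lm(4) act_eval_diff act_eval_letter2
        using path_act_idm[OF src_closed[OF lm(1)] \<xi>]
        by (auto simp: act_eval_letter simp del: letter_act.simps)
    qed
  next
    case 5
    then obtain v n where v: "v \<in> Obj \<Lambda>"
      "x = kp_path (idm \<Lambda> v) - (\<Sum>l \<in> paths_to \<Lambda> v n. kp_path l * kp_ghost l)"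
      unfolding kp4_def by blast
    show ?thesis
    proof (rule kills_large_pathsI)
      fix \<xi> m and g :: "'m \<Rightarrow> 'f"
      assume \<xi>: "\<xi> \<in> Mor \<Lambda>" "deg \<Lambda> \<xi> = n + m"
      obtain \<alpha> \<delta> where \<alpha>: "\<alpha> \<in> Mor \<Lambda>" "\<delta> \<in> Mor \<Lambda>" "src \<Lambda> \<alpha> = rng \<Lambda> \<delta>" "deg \<Lambda> \<alpha> = n"
        "deg \<Lambda> \<delta> = m" "\<xi> = cmp \<Lambda> \<alpha> \<delta>"
        using \<xi> by (rule factor_exists)
      have act: "opt_app g (Option.bind (letter_act (Ghost l) \<xi>) (letter_act (Path l)))
          = (if l = \<alpha> then g \<xi> else 0)" if "l \<in> paths_to \<Lambda> v n" for l
        using that ghost_act_cmp[of l \<alpha> \<delta>] \<alpha> by (auto simp: paths_to_def)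
      have "(\<Sum>l\<in>paths_to \<Lambda> v n. act_eval g \<xi> (kp_path l * kp_ghost l))
          = (\<Sum>l\<in>paths_to \<Lambda> v n. if l = \<alpha> then g \<xi> else 0)"
        unfolding act_eval_letter2 by (intro sum.cong refl act)
      also have "\<dots> = (if \<alpha> \<in> paths_to \<Lambda> v n then g \<xi> else 0)"
        using row_finite v(1) by (simp add: row_finite_def)
      also have "\<alpha> \<in> paths_to \<Lambda> v n \<longleftrightarrow> rng \<Lambda> \<xi> = v"
        using \<alpha> by (auto simp: paths_to_def rng_cmp)
      finally show "act_eval g \<xi> x = 0"
        unfolding v(2) act_eval_diff act_eval_sum act_eval_letter path_act_idm[OF v(1) \<xi>(1)]
        by simp
    qed
  qed
qed

text \<open>Every element of the ideal kills all large paths, but a vertex fixes the paths that end in it,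
  and without sources there are arbitrarily large ones.\<close>

lemma vertex_not_in_kp_ideal:
  assumes "row_finite \<Lambda>" "no_sources \<Lambda>" "v \<in> Obj \<Lambda>"
  shows "kp_path (idm \<Lambda> v) \<notin> (kp_ideal \<Lambda> :: ('m kp_letter word \<Rightarrow>\<^sub>0 'f::field) set)"
proof
  let ?v = "kp_path (idm \<Lambda> v) :: 'm kp_letter word \<Rightarrow>\<^sub>0 'f"
  have "kp_ideal \<Lambda> \<subseteq> {p \<in> free_carrier (kp_letters \<Lambda>). kills_large_paths (p :: _ \<Rightarrow>\<^sub>0 'f)}"
    unfolding kp_ideal_def
    using kp_relators_subset kp_relators_kill_large_paths[OF assms(1)]
    by (intro genideal_least kills_large_paths_ideal subsetI CollectI conjI) (erule subsetD, simp)+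
  moreover assume "?v \<in> kp_ideal \<Lambda>"
  ultimately have "kills_large_paths ?v" by (simp add: subset_iff)
  then obtain N where N: "\<And>l m g. l \<in> Mor \<Lambda> \<Longrightarrow> deg \<Lambda> l = N + m \<Longrightarrow> act_eval g l ?v = 0"
    unfolding kills_large_paths_def by metis
  have "paths_to \<Lambda> v N \<noteq> {}"
    using assms(2,3) by (simp add: no_sources_def)
  then obtain l where l: "l \<in> Mor \<Lambda>" "deg \<Lambda> l = N + 0" "rng \<Lambda> l = v"
    by (auto simp: paths_to_def)
  from N[OF l(1,2), of "\<lambda>_. 1"] show False
    unfolding act_eval_letter path_act_idm[OF assms(3) l(1)] by (simp add: l(3))
qed

end


section \<open>Calculations in a Kumjian-Pask algebra\<close>

locale kumjian_pask = k_graph \<Lambda> for \<Lambda> :: "('o, 'm, 'k::finite) kgraph" +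
  fixes K :: "'f::field itself"
  assumes row_finite: "row_finite \<Lambda>" and no_sources: "no_sources \<Lambda>"
begin

sublocale free_alg_quot "kp_letters \<Lambda>" "kp_ideal \<Lambda> :: ('m kp_letter word \<Rightarrow>\<^sub>0 'f) set"
  unfolding kp_ideal_def by unfold_locales (rule genideal_ideal[OF kp_relators_subset])

notation cong (infix "\<approx>" 50)

abbreviation vertex :: "'o \<Rightarrow> 'm kp_letter word \<Rightarrow>\<^sub>0 'f" where
  "vertex v \<equiv> kp_path (idm \<Lambda> v)"

abbreviation opt_path :: "'m option \<Rightarrow> 'm kp_letter word \<Rightarrow>\<^sub>0 'f" where
  "opt_path o' \<equiv> (case o' of None \<Rightarrow> 0 | Some l \<Rightarrow> kp_path l)"

lemma vertex_not_in_ideal: "v \<in> Obj \<Lambda> \<Longrightarrow> vertex v \<notin> kp_ideal \<Lambda>"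
  using row_finite no_sources by (rule vertex_not_in_kp_ideal)

lemma vertex_carrier: "v \<in> Obj \<Lambda> \<Longrightarrow> vertex v \<in> F"
  by (intro path_carrier idm_closed)

lemma relator_cong: "a - b \<in> kp_relators \<Lambda> \<Longrightarrow> a \<approx> b"
  unfolding cong_def unfolding kp_ideal_def by (rule subsetD[OF genideal_superset])

lemma ghost_vertex: "v \<in> Obj \<Lambda> \<Longrightarrow> kp_ghost (idm \<Lambda> v) \<approx> vertex v"
  by (rule relator_cong) (auto simp: kp0_def)

lemma vertex_mult:
  assumes "v \<in> Obj \<Lambda>" "w \<in> Obj \<Lambda>"
  shows "vertex v * vertex w \<approx> (if v = w then vertex w else 0)"
proof (rule relator_cong)
  have "vertex v * vertex w - (if v = w then vertex w else 0) \<in> kp1 \<Lambda>"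
    unfolding kp1_def using assms by blast
  then show "vertex v * vertex w - (if v = w then vertex w else 0) \<in> kp_relators \<Lambda>" by blast
qed

lemma path_mult:
  assumes "l \<in> Mor \<Lambda>" "m \<in> Mor \<Lambda>" "src \<Lambda> l = rng \<Lambda> m"
  shows "kp_path l * kp_path m \<approx> kp_path (cmp \<Lambda> l m)"
proof (rule relator_cong)
  have "kp_path l * kp_path m - kp_path (cmp \<Lambda> l m) \<in> kp2 \<Lambda>"
    unfolding kp2_def using assms(1,2) assms(3)[symmetric] by blast
  then show "kp_path l * kp_path m - kp_path (cmp \<Lambda> l m) \<in> kp_relators \<Lambda>" by blast
qed

lemma ghost_mult:
  assumes "l \<in> Mor \<Lambda>" "m \<in> Mor \<Lambda>" "src \<Lambda> l = rng \<Lambda> m"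
  shows "kp_ghost m * kp_ghost l \<approx> kp_ghost (cmp \<Lambda> l m)"
proof (rule relator_cong)
  have "kp_ghost m * kp_ghost l - kp_ghost (cmp \<Lambda> l m) \<in> kp2 \<Lambda>"
    unfolding kp2_def using assms(1,2) assms(3)[symmetric] by blast
  then show "kp_ghost m * kp_ghost l - kp_ghost (cmp \<Lambda> l m) \<in> kp_relators \<Lambda>" by blast
qed

lemma ghost_path_mult:
  assumes "l \<in> Mor \<Lambda>" "m \<in> Mor \<Lambda>" "deg \<Lambda> l = deg \<Lambda> m"
  shows "kp_ghost l * kp_path m \<approx> (if l = m then vertex (src \<Lambda> l) else 0)"
proof (rule relator_cong)
  have "kp_ghost l * kp_path m - (if l = m then vertex (src \<Lambda> l) else 0) \<in> kp3 \<Lambda>"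
    unfolding kp3_def using assms by blast
  then show "kp_ghost l * kp_path m - (if l = m then vertex (src \<Lambda> l) else 0) \<in> kp_relators \<Lambda>"
    by blast
qed

text \<open>The vertices that act as identities on a letter from the left and from the right.\<close>

primrec left_vertex :: "'m kp_letter \<Rightarrow> 'o" where
  "left_vertex (Path l) = rng \<Lambda> l"
| "left_vertex (Ghost l) = src \<Lambda> l"

primrec right_vertex :: "'m kp_letter \<Rightarrow> 'o" where
  "right_vertex (Path l) = src \<Lambda> l"
| "right_vertex (Ghost l) = rng \<Lambda> l"

abbreviation letter :: "'m kp_letter \<Rightarrow> 'm kp_letter word \<Rightarrow>\<^sub>0 'f" where
  "letter x \<equiv> Poly_Mapping.single (Word [x]) 1"

lemma left_vertex_Obj: "x \<in> kp_letters \<Lambda> \<Longrightarrow> left_vertex x \<in> Obj \<Lambda>"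
  and right_vertex_Obj: "x \<in> kp_letters \<Lambda> \<Longrightarrow> right_vertex x \<in> Obj \<Lambda>"
  by (auto simp: kp_letters_def rng_closed src_closed)

lemma left_vertex_letter:
  assumes "x \<in> kp_letters \<Lambda>"
  shows "vertex (left_vertex x) * letter x \<approx> letter x"
proof (cases x)
  case (Path l)
  then have l: "l \<in> Mor \<Lambda>" using assms by (auto simp: kp_letters_def)
  have "vertex (rng \<Lambda> l) * kp_path l \<approx> kp_path (cmp \<Lambda> (idm \<Lambda> (rng \<Lambda> l)) l)"
    using l by (intro path_mult) (simp_all add: idm_closed rng_closed src_idm)
  with Path l show ?thesis by (simp add: cmp_idm_left)
next
  case (Ghost l)
  then have l: "l \<in> Mor \<Lambda>" using assms by (auto simp: kp_letters_def)
  then have s: "src \<Lambda> l \<in> Obj \<Lambda>" by (rule src_closed)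
  have "vertex (src \<Lambda> l) * kp_ghost l \<approx> kp_ghost (idm \<Lambda> (src \<Lambda> l)) * kp_ghost l"
    by (rule cong_mult_right[OF ghost_carrier[OF l] cong_sym[OF ghost_vertex[OF s]]])
  also have "\<dots> \<approx> kp_ghost (cmp \<Lambda> l (idm \<Lambda> (src \<Lambda> l)))"
    by (rule ghost_mult) (simp_all add: l s idm_closed rng_idm)
  finally show ?thesis using Ghost l by (simp add: cmp_idm_right)
qed

lemma right_vertex_letter:
  assumes "x \<in> kp_letters \<Lambda>"
  shows "letter x * vertex (right_vertex x) \<approx> letter x"
proof (cases x)
  case (Path l)
  then have l: "l \<in> Mor \<Lambda>" using assms by (auto simp: kp_letters_def)
  have "kp_path l * vertex (src \<Lambda> l) \<approx> kp_path (cmp \<Lambda> l (idm \<Lambda> (src \<Lambda> l)))"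
    using l by (intro path_mult) (simp_all add: idm_closed src_closed rng_idm)
  with Path l show ?thesis by (simp add: cmp_idm_right)
next
  case (Ghost l)
  then have l: "l \<in> Mor \<Lambda>" using assms by (auto simp: kp_letters_def)
  then have s: "rng \<Lambda> l \<in> Obj \<Lambda>" by (rule rng_closed)
  have "kp_ghost l * vertex (rng \<Lambda> l) \<approx> kp_ghost l * kp_ghost (idm \<Lambda> (rng \<Lambda> l))"
    by (rule cong_mult_left[OF ghost_carrier[OF l] cong_sym[OF ghost_vertex[OF s]]])
  also have "\<dots> \<approx> kp_ghost (cmp \<Lambda> (idm \<Lambda> (rng \<Lambda> l)) l)"
    by (rule ghost_mult) (simp_all add: l s idm_closed src_idm)
  finally show ?thesis using Ghost l by (simp add: cmp_idm_left)
qed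

lemma vertex_letter:
  assumes "v \<in> Obj \<Lambda>" "x \<in> kp_letters \<Lambda>"
  shows "vertex v * letter x \<approx> (if v = left_vertex x then letter x else 0)"
proof (cases "v = left_vertex x")
  case True
  then show ?thesis using left_vertex_letter[OF assms(2)] by simp
next
  case False
  let ?w = "left_vertex x"
  have w: "?w \<in> Obj \<Lambda>" by (rule left_vertex_Obj[OF assms(2)])
  have x: "letter x \<in> F" using assms(2) by (rule letter_in_free_carrier)
  have "vertex v * letter x \<approx> vertex v * (vertex ?w * letter x)"
    by (rule cong_mult_left[OF vertex_carrier[OF assms(1)] cong_sym[OF left_vertex_letter[OF assms(2)]]])
  also have "\<dots> = (vertex v * vertex ?w) * letter x"
    by (rule mult.assoc[symmetric])
  also have "\<dots> \<approx> (if v = ?w then vertex ?w else 0) * letter x"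
    by (rule cong_mult_right[OF x vertex_mult[OF assms(1) w]])
  finally show ?thesis using False by simp
qed

lemma letter_vertex:
  assumes "v \<in> Obj \<Lambda>" "x \<in> kp_letters \<Lambda>"
  shows "letter x * vertex v \<approx> (if v = right_vertex x then letter x else 0)"
proof (cases "v = right_vertex x")
  case True
  then show ?thesis using right_vertex_letter[OF assms(2)] by simp
next
  case False
  let ?w = "right_vertex x"
  have w: "?w \<in> Obj \<Lambda>" by (rule right_vertex_Obj[OF assms(2)])
  have x: "letter x \<in> F" using assms(2) by (rule letter_in_free_carrier)
  have "letter x * vertex v \<approx> (letter x * vertex ?w) * vertex v"
    by (rule cong_mult_right[OF vertex_carrier[OF assms(1)] cong_sym[OF right_vertex_letter[OF assms(2)]]])
  also have "\<dots> = letter x * (vertex ?w * vertex v)"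
    by (rule mult.assoc)
  also have "\<dots> \<approx> letter x * (if ?w = v then vertex v else 0)"
    by (rule cong_mult_left[OF x vertex_mult[OF w assms(1)]])
  finally show ?thesis using False by simp
qed

text \<open>The next two facts include multiples of the empty word, which do not belong to the algebra; they
  arise as the rest of a one-letter word.\<close>

lemma cong_mult_monomial_right:
  assumes "p \<approx> q" "set (letters w) \<subseteq> kp_letters \<Lambda>"
  shows "p * Poly_Mapping.single w c \<approx> q * Poly_Mapping.single w c"
proof (cases "w = 0")
  case True
  with cong_scale[OF assms(1), of c] show ?thesis by (simp add: scale_commute)
next
  case False
  then show ?thesis by (intro cong_mult_right assms single_in_free_carrier)
qed

lemma cong_mult_monomial_left:
  assumes "p \<approx> q" "set (letters w) \<subseteq> kp_letters \<Lambda>"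
  shows "Poly_Mapping.single w c * p \<approx> Poly_Mapping.single w c * q"
proof (cases "w = 0")
  case True
  with cong_scale[OF assms(1), of c] show ?thesis by simp
next
  case False
  then show ?thesis by (intro cong_mult_left assms single_in_free_carrier)
qed

lemma single_Cons: "Poly_Mapping.single (Word (x # xs)) c = letter x * Poly_Mapping.single (Word xs) c"
  by (simp add: mult_single word_append)

lemma single_snoc: "Poly_Mapping.single (Word (xs @ [x])) c = Poly_Mapping.single (Word xs) c * letter x"
  by (simp add: mult_single word_append)

text \<open>A vertex kills every word whose first letter has a different left vertex, and only finitely many
  words occur in \<open>p\<close>.\<close>

lemma finite_left_support:
  assumes "p \<in> F"
  shows "finite {v \<in> Obj \<Lambda>. \<not> vertex v * p \<approx> 0}"
  using assms
proof (induction rule: free_carrier_induct)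
  case (monomial w c)
  then obtain x xs where w: "w = Word (x # xs)"
    by (cases w; cases "letters w") (auto simp: zero_word_def)
  have x: "x \<in> kp_letters \<Lambda>" "set (letters (Word xs)) \<subseteq> kp_letters \<Lambda>"
    using monomial(2) w by simp_all
  have "vertex v * Poly_Mapping.single w c \<approx> 0" if "v \<in> Obj \<Lambda>" "v \<noteq> left_vertex x" for v
  proof -
    have "(vertex v * letter x) * Poly_Mapping.single (Word xs) c
        \<approx> (if v = left_vertex x then letter x else 0) * Poly_Mapping.single (Word xs) c"
      by (rule cong_mult_monomial_right[OF vertex_letter[OF that(1) x(1)] x(2)])
    then show ?thesis using that(2) unfolding w single_Cons[of x xs c] by (simp add: mult.assoc)
  qed
  then have "{v \<in> Obj \<Lambda>. \<not> vertex v * Poly_Mapping.single w c \<approx> 0} \<subseteq> {left_vertex x}"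
    by blast
  then show ?case by (rule finite_subset) simp
next
  case (add p q)
  have "vertex v * (p + q) \<approx> 0" if "vertex v * p \<approx> 0" "vertex v * q \<approx> 0" for v
    using cong_add[OF that] by (simp add: distrib_left)
  then have "{v \<in> Obj \<Lambda>. \<not> vertex v * (p + q) \<approx> 0}
      \<subseteq> {v \<in> Obj \<Lambda>. \<not> vertex v * p \<approx> 0} \<union> {v \<in> Obj \<Lambda>. \<not> vertex v * q \<approx> 0}"
    by blast
  then show ?case using add(3,4) by (rule finite_subset[OF _ finite_UnI])
qed simp

lemma sum_vertices_identity:
  assumes fin: "finite (Obj \<Lambda>)" and p: "p \<in> F"
  shows "(\<Sum>v\<in>Obj \<Lambda>. vertex v) * p \<approx> p" "p * (\<Sum>v\<in>Obj \<Lambda>. vertex v) \<approx> p"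
proof -
  let ?e = "\<Sum>v\<in>Obj \<Lambda>. vertex v"
  have left: "?e * letter x \<approx> letter x" and right: "letter x * ?e \<approx> letter x"
    if x: "x \<in> kp_letters \<Lambda>" for x
  proof -
    have "(\<Sum>v\<in>Obj \<Lambda>. vertex v * letter x) \<approx> (\<Sum>v\<in>Obj \<Lambda>. if v = left_vertex x then letter x else 0)"
      by (intro cong_sum vertex_letter x)
    then show "?e * letter x \<approx> letter x"
      using fin left_vertex_Obj[OF x] by (simp add: sum_distrib_right)
    have "(\<Sum>v\<in>Obj \<Lambda>. letter x * vertex v) \<approx> (\<Sum>v\<in>Obj \<Lambda>. if v = right_vertex x then letter x else 0)"
      by (intro cong_sum letter_vertex x)
    then show "letter x * ?e \<approx> letter x"
      using fin right_vertex_Obj[OF x] by (simp add: sum_distrib_left)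
  qed
  show "?e * p \<approx> p"
    using p
  proof (induction rule: free_carrier_induct)
    case (monomial w c)
    then obtain x xs where w: "w = Word (x # xs)"
      by (cases w; cases "letters w") (auto simp: zero_word_def)
    have x: "x \<in> kp_letters \<Lambda>" "set (letters (Word xs)) \<subseteq> kp_letters \<Lambda>"
      using monomial(2) w by simp_all
    from cong_mult_monomial_right[OF left[OF x(1)] x(2), of c] show ?case
      unfolding w single_Cons[of x xs c] mult.assoc .
  next
    case (add p q)
    show ?case unfolding distrib_left by (rule cong_add[OF add(3,4)])
  qed simp
  show "p * ?e \<approx> p"
    using p
  proof (induction rule: free_carrier_induct)
    case (monomial w c)
    then obtain xs x where w: "w = Word (xs @ [x])"
      by (cases w; cases "letters w" rule: rev_cases) (auto simp: zero_word_def)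
    have x: "x \<in> kp_letters \<Lambda>" "set (letters (Word xs)) \<subseteq> kp_letters \<Lambda>"
      using monomial(2) w by simp_all
    from cong_mult_monomial_left[OF right[OF x(1)] x(2), of c] show ?case
      unfolding w single_snoc mult.assoc .
  next
    case (add p q)
    show ?case unfolding distrib_right by (rule cong_add[OF add(3,4)])
  qed simp
qed

text \<open>For a ghost path \<open>\<alpha>\<^sup>*\<close> the bound on the degree gives \<open>l = \<gamma> \<delta>\<close> with \<open>\<gamma>\<close> of the same degree as
  \<open>\<alpha>\<close>, and then \<open>\<alpha>\<^sup>* \<gamma>\<close> is \<open>s(\<alpha>)\<close> or zero by the relations.\<close>

lemma letter_large_path:
  assumes x: "x \<in> kp_letters \<Lambda>" and l: "l \<in> Mor \<Lambda>" "deg \<Lambda> l = letter_weight x + n"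
  shows "letter x * kp_path l \<approx> opt_path (letter_act x l)"
proof (cases x)
  case (Path \<alpha>)
  then have \<alpha>: "\<alpha> \<in> Mor \<Lambda>" using x by (auto simp: kp_letters_def)
  show ?thesis
  proof (cases "src \<Lambda> \<alpha> = rng \<Lambda> l")
    case True
    with path_mult[OF \<alpha> l(1)] Path show ?thesis by simp
  next
    case False
    have Pl: "Path l \<in> kp_letters \<Lambda>" using l by (simp add: kp_letters_def)
    have "letter x * kp_path l \<approx> (letter x * vertex (right_vertex x)) * kp_path l"
      by (rule cong_mult_right[OF path_carrier[OF l(1)] cong_sym[OF right_vertex_letter[OF x]]])
    also have "\<dots> = letter x * (vertex (right_vertex x) * letter (Path l))"
      by (rule mult.assoc)
    also have "\<dots> \<approx> letter x * (if right_vertex x = left_vertex (Path l) then letter (Path l) else 0)"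
      by (rule cong_mult_left[OF letter_in_free_carrier[OF x]
          vertex_letter[OF right_vertex_Obj[OF x] Pl]])
    finally show ?thesis using Path False by simp
  qed
next
  case (Ghost \<alpha>)
  then have \<alpha>: "\<alpha> \<in> Mor \<Lambda>" using x by (auto simp: kp_letters_def)
  have "deg \<Lambda> l = deg \<Lambda> \<alpha> + n" using l(2) Ghost by simp
  then obtain \<gamma> \<delta> where \<gamma>: "\<gamma> \<in> Mor \<Lambda>" "\<delta> \<in> Mor \<Lambda>" "src \<Lambda> \<gamma> = rng \<Lambda> \<delta>" "deg \<Lambda> \<gamma> = deg \<Lambda> \<alpha>"
    "deg \<Lambda> \<delta> = n" "l = cmp \<Lambda> \<gamma> \<delta>"
    by (rule factor_exists[OF l(1)])
  have "kp_ghost \<alpha> * kp_path l \<approx> kp_ghost \<alpha> * (kp_path \<gamma> * kp_path \<delta>)"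
    unfolding \<gamma>(6) by (rule cong_mult_left[OF ghost_carrier[OF \<alpha>] cong_sym[OF path_mult[OF \<gamma>(1-3)]]])
  also have "\<dots> = (kp_ghost \<alpha> * kp_path \<gamma>) * kp_path \<delta>"
    by (rule mult.assoc[symmetric])
  also have "\<dots> \<approx> (if \<alpha> = \<gamma> then vertex (src \<Lambda> \<alpha>) else 0) * kp_path \<delta>"
    by (rule cong_mult_right[OF path_carrier[OF \<gamma>(2)] ghost_path_mult[OF \<alpha> \<gamma>(1) \<gamma>(4)[symmetric]]])
  also have "\<dots> \<approx> (if \<alpha> = \<gamma> then kp_path \<delta> else 0)"
    using left_vertex_letter[of "Path \<delta>"] \<gamma>(2,3) by (simp add: kp_letters_def)
  also have "(if \<alpha> = \<gamma> then kp_path \<delta> else 0) = opt_path (letter_act (Ghost \<alpha>) l)"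
    unfolding \<gamma>(6) by (simp add: ghost_act_cmp[OF \<alpha> \<gamma>(1-4)])
  finally show ?thesis unfolding Ghost .
qed

text \<open>The degree bound survives each letter, so that the preceding lemma applies letter by letter. It
  identifies the abstract product with the action that was used to show that vertices are nonzero.\<close>

lemma word_large_path:
  assumes "set xs \<subseteq> kp_letters \<Lambda>" "l \<in> Mor \<Lambda>" "deg \<Lambda> l = weight xs + n"
  shows "Poly_Mapping.single (Word xs) 1 * kp_path l \<approx> opt_path (list_act xs l)"
  using assms
proof (induction xs arbitrary: n)
  case Nil
  then show ?case by (simp add: zero_word_def[symmetric])
next
  case (Cons x xs)
  have x: "x \<in> kp_letters \<Lambda>" and xs: "set xs \<subseteq> kp_letters \<Lambda>"
    using Cons.prems(1) by simp_all
  have d: "deg \<Lambda> l = weight xs + (letter_weight x + n)"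
    using Cons.prems(3) by (simp add: algebra_simps)
  have "letter x * (Poly_Mapping.single (Word xs) 1 * kp_path l) \<approx> letter x * opt_path (list_act xs l)"
    by (rule cong_mult_left[OF letter_in_free_carrier[OF x] Cons.IH[OF xs Cons.prems(2) d]])
  also have "\<dots> \<approx> opt_path (list_act (x # xs) l)"
  proof (cases "list_act xs l")
    case (Some \<nu>)
    obtain r where "deg \<Lambda> \<nu> = letter_weight x + (n + r)"
      using list_act_deg[OF xs Cons.prems(2) Some d] by (auto simp: add.assoc)
    moreover have "\<nu> \<in> Mor \<Lambda>" using list_act_Some[OF xs Cons.prems(2) Some] by simp
    ultimately have "letter x * kp_path \<nu> \<approx> opt_path (letter_act x \<nu>)"
      using letter_large_path[OF x] by simp
    with Some show ?thesis by simp
  qed simp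
  finally show ?case unfolding single_Cons[of x xs] mult.assoc .
qed

text \<open>An element \<open>z\<close> of degree \<open>0\<close> turns a large path \<open>l\<close> into a combination of paths of the same
  degree, of which \<open>l\<^sup>*\<close> picks out the coefficient of \<open>l\<close>.\<close>

lemma degree_0_compression:
  assumes z: "z \<in> F" "homogeneous letter_deg 0 z" and v: "v \<in> Obj \<Lambda>"
  shows "\<exists>l\<in>Mor \<Lambda>. \<exists>c. (kp_ghost l * z) * kp_path l \<approx> Poly_Mapping.single 0 c * vertex (src \<Lambda> l)"
proof -
  let ?K = "Poly_Mapping.keys z" and ?c = "Poly_Mapping.lookup z"
  \<comment> \<open>The sum of the weights serves as an upper bound for all of them.\<close>
  define N where "N = (\<Sum>w\<in>?K. weight (letters w))"
  obtain l where l: "l \<in> Mor \<Lambda>" "deg \<Lambda> l = N"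
    using no_sources v by (auto simp: no_sources_def paths_to_def)
  define c where "c = (\<Sum>w\<in>?K. if list_act (letters w) l = Some l then ?c w else 0)"
  have word: "kp_ghost l * (Poly_Mapping.single w (?c w) * kp_path l)
      \<approx> Poly_Mapping.single 0 (if list_act (letters w) l = Some l then ?c w else 0) * vertex (src \<Lambda> l)"
    if w: "w \<in> ?K" for w
  proof -
    have ws: "set (letters w) \<subseteq> kp_letters \<Lambda>" using z(1) w by (simp add: free_carrier_iff)
    have "N = weight (letters w) + (\<Sum>w\<in>?K - {w}. weight (letters w))"
      unfolding N_def by (rule sum.remove) (simp_all add: w)
    then have "deg \<Lambda> l = weight (letters w) + (\<Sum>w\<in>?K - {w}. weight (letters w))"
      using l(2) by simp
    from word_large_path[OF ws l(1) this]
    have "Poly_Mapping.single w 1 * kp_path l \<approx> opt_path (list_act (letters w) l)"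
      by simp
    then have "kp_ghost l * (Poly_Mapping.single w 1 * kp_path l)
        \<approx> kp_ghost l * opt_path (list_act (letters w) l)"
      by (rule cong_mult_left[OF ghost_carrier[OF l(1)]])
    also have "\<dots> \<approx> (if list_act (letters w) l = Some l then vertex (src \<Lambda> l) else 0)"
    proof (cases "list_act (letters w) l")
      case (Some \<mu>)
      have "word_deg letter_deg w = 0" using z(2) w by (simp add: homogeneous_def)
      then have "\<mu> \<in> Mor \<Lambda>" "letter_deg (Path \<mu>) = letter_deg (Path l)"
        using list_act_Some[OF ws l(1) Some] by (simp_all add: word_deg_def)
      then have "\<mu> \<in> Mor \<Lambda>" "deg \<Lambda> l = deg \<Lambda> \<mu>" by (simp_all add: vec_eq_iff)
      from ghost_path_mult[OF l(1) this] show ?thesis unfolding Some by (cases "\<mu> = l") auto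
    qed simp
    finally have "Poly_Mapping.single 0 (?c w) * (kp_ghost l * (Poly_Mapping.single w 1 * kp_path l))
        \<approx> Poly_Mapping.single 0 (?c w)
          * (if list_act (letters w) l = Some l then vertex (src \<Lambda> l) else 0)"
      by (rule cong_scale)
    then show ?thesis
      unfolding scale_left_commute[symmetric]
      by (simp add: mult.assoc[symmetric] mult_single if_distrib cong: if_cong)
  qed
  have "(kp_ghost l * z) * kp_path l
      = (kp_ghost l * (\<Sum>w\<in>?K. Poly_Mapping.single w (?c w))) * kp_path l"
    by (simp only: sum_monomials)
  also have "\<dots> = (\<Sum>w\<in>?K. kp_ghost l * (Poly_Mapping.single w (?c w) * kp_path l))"
    by (simp only: sum_distrib_left sum_distrib_right mult.assoc)
  also have "\<dots> \<approx> (\<Sum>w\<in>?K. Poly_Mapping.single 0 (if list_act (letters w) l = Some l then ?c w else 0)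
      * vertex (src \<Lambda> l))"
    by (intro cong_sum word)
  also have "\<dots> = Poly_Mapping.single 0 c * vertex (src \<Lambda> l)"
  proof -
    have "(Poly_Mapping.single 0 c :: 'm kp_letter word \<Rightarrow>\<^sub>0 'f)
        = (\<Sum>w\<in>?K. Poly_Mapping.single 0 (if list_act (letters w) l = Some l then ?c w else 0))"
      unfolding c_def by (rule poly_mapping_eqI) (simp add: lookup_sum lookup_single when_def)
    then show ?thesis by (simp only: sum_distrib_right)
  qed
  finally show ?thesis using l(1) by blast
qed

end

section \<open>The centre of a simple Kumjian-Pask algebra\<close>

locale simple_kumjian_pask = kumjian_pask \<Lambda> K
  for \<Lambda> :: "('o, 'm, 'k::finite) kgraph" and K :: "'f::field itself" +
  assumes simple_kp: "alg_simple (kp_alg K \<Lambda>)"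
begin

sublocale graded_simple_quot "kp_letters \<Lambda>" "kp_ideal \<Lambda> :: ('m kp_letter word \<Rightarrow>\<^sub>0 'f) set" letter_deg
proof
  show "alg_simple Q" using simple_kp by (simp add: kp_alg_def)
  show "component letter_deg n p \<in> kp_ideal \<Lambda>" if "p \<in> kp_ideal \<Lambda>" for n p
    using that unfolding kp_ideal_def
    by (intro genideal_component[OF kp_relators_subset] kp_relators_homogeneous)
qed

lemma Obj_nonempty: "Obj \<Lambda> \<noteq> {}"
proof
  assume "Obj \<Lambda> = {}"
  then have empty: "kp_letters \<Lambda> = {}"
    using rng_closed by (auto simp: kp_letters_def)
  have "a = 0" if "a \<in> F" for a
    using that
  proof (induction rule: free_carrier_induct)
    case (monomial w c)
    then show ?case unfolding empty by (cases w) (simp add: zero_word_def)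
  qed simp_all
  with mult_nonzero show False by fastforce
qed

text \<open>For \<open>z\<close> central of degree \<open>0\<close> and a large path \<open>l\<close>, the vertex \<open>s(l)\<close> is an eigenvector of \<open>z\<close>,
  because \<open>z s(l) = z l\<^sup>* l = l\<^sup>* z l = c s(l)\<close>.\<close>

lemma central_acts_as_scalar:
  assumes z: "central z"
  shows "\<exists>c. \<forall>a\<in>F. z * a \<approx> Poly_Mapping.single 0 c * a"
proof -
  obtain v where v: "v \<in> Obj \<Lambda>" using Obj_nonempty by blast
  let ?z = "component letter_deg 0 z"
  have z0: "z \<approx> ?z"
    by (rule central_cong_component_0[OF z vertex_carrier[OF v] vertex_not_in_ideal[OF v]
        homogeneous_idm[OF v]])
  have c0: "central ?z" by (rule central_component[OF z])
  then have zF: "?z \<in> F" and za: "\<And>a. a \<in> F \<Longrightarrow> ?z * a \<approx> a * ?z"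
    by (simp_all add: central_def)
  obtain l c where l: "l \<in> Mor \<Lambda>"
    and lc: "(kp_ghost l * ?z) * kp_path l \<approx> Poly_Mapping.single 0 c * vertex (src \<Lambda> l)"
    using degree_0_compression[OF zF homogeneous_component v] by blast
  have s: "src \<Lambda> l \<in> Obj \<Lambda>" by (rule src_closed[OF l])
  have "?z * vertex (src \<Lambda> l) \<approx> ?z * (kp_ghost l * kp_path l)"
    using ghost_path_mult[OF l l refl] by (intro cong_mult_left zF) (simp add: cong_sym)
  also have "\<dots> = (?z * kp_ghost l) * kp_path l" by (rule mult.assoc[symmetric])
  also have "\<dots> \<approx> (kp_ghost l * ?z) * kp_path l"
    by (rule cong_mult_right[OF path_carrier[OF l] za[OF ghost_carrier[OF l]]])
  also note lc
  finally have zs: "?z * vertex (src \<Lambda> l) \<approx> Poly_Mapping.single 0 c * vertex (src \<Lambda> l)" .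
  have "z * a \<approx> Poly_Mapping.single 0 c * a" if a: "a \<in> F" for a
    using cong_mult_right[OF a z0]
      central_scalar[OF c0 vertex_carrier[OF s] vertex_not_in_ideal[OF s] zs a]
    by (rule cong_trans)
  then show ?thesis by blast
qed

text \<open>The scalar \<open>c\<close> is zero because a vertex \<open>v\<close> with \<open>v z = 0\<close> satisfies \<open>c v = z v = v z = 0\<close>.\<close>

lemma center_infinite:
  assumes "infinite (Obj \<Lambda>)" and z: "central z"
  shows "z \<approx> 0"
proof -
  have zF: "z \<in> F" and za: "\<And>a. a \<in> F \<Longrightarrow> z * a \<approx> a * z"
    using z by (simp_all add: central_def)
  obtain c where c: "\<And>a. a \<in> F \<Longrightarrow> z * a \<approx> Poly_Mapping.single 0 c * a"
    using central_acts_as_scalar[OF z] by blast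
  obtain v where v: "v \<in> Obj \<Lambda>" "vertex v * z \<approx> 0"
    using finite_left_support[OF zF] assms(1)
    by (metis (mono_tags, lifting) infinite_super mem_Collect_eq subsetI)
  have "Poly_Mapping.single 0 c * vertex v \<approx> z * vertex v"
    by (rule cong_sym[OF c[OF vertex_carrier[OF v(1)]]])
  also have "\<dots> \<approx> vertex v * z" by (rule za[OF vertex_carrier[OF v(1)]])
  also note v(2)
  finally have cv: "Poly_Mapping.single 0 c * vertex v \<approx> 0" .
  have "c = 0"
  proof (rule ccontr)
    assume "c \<noteq> 0"
    then have "vertex v \<approx> 0"
      using cong_scale[OF cv, of "inverse c"] by (simp add: mult_single mult.assoc[symmetric])
    with vertex_not_in_ideal[OF v(1)] show False by (simp add: cong_0_iff)
  qed
  then have "z * a \<in> kp_ideal \<Lambda>" if "a \<in> F" for a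
    using c[OF that] by (simp add: cong_0_iff)
  then show ?thesis
    using annihilator_trivial[OF zF] by (simp add: cong_0_iff)
qed

lemma center_finite:
  assumes fin: "finite (Obj \<Lambda>)"
  shows "central z \<longleftrightarrow> z \<in> F \<and> (\<exists>c. z \<approx> Poly_Mapping.single 0 c * (\<Sum>v\<in>Obj \<Lambda>. vertex v))"
proof -
  let ?e = "\<Sum>v\<in>Obj \<Lambda>. vertex v"
  have eF: "?e \<in> F" by (intro sum_in_free_carrier vertex_carrier)
  show ?thesis
  proof (intro iffI conjI)
    assume z: "central z"
    then show zF: "z \<in> F" by (simp add: central_def)
    obtain c where c: "\<And>a. a \<in> F \<Longrightarrow> z * a \<approx> Poly_Mapping.single 0 c * a"
      using central_acts_as_scalar[OF z] by blast
    have "z \<approx> Poly_Mapping.single 0 c * ?e"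
      by (rule cong_trans[OF cong_sym[OF sum_vertices_identity(2)[OF fin zF]] c[OF eF]])
    then show "\<exists>c. z \<approx> Poly_Mapping.single 0 c * ?e" ..
  next
    assume "z \<in> F \<and> (\<exists>c. z \<approx> Poly_Mapping.single 0 c * ?e)"
    then obtain c where zF: "z \<in> F" and z: "z \<approx> Poly_Mapping.single 0 c * ?e" by blast
    have "z * a \<approx> a * z" if a: "a \<in> F" for a
    proof -
      have "z * a \<approx> Poly_Mapping.single 0 c * (?e * a)"
        using cong_mult_right[OF a z] by (simp only: mult.assoc)
      also have "\<dots> \<approx> Poly_Mapping.single 0 c * (a * ?e)"
        by (rule cong_scale[OF cong_trans[OF sum_vertices_identity(1)[OF fin a]
              cong_sym[OF sum_vertices_identity(2)[OF fin a]]]])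
      also have "\<dots> = a * (Poly_Mapping.single 0 c * ?e)"
        by (rule scale_left_commute[symmetric])
      also have "\<dots> \<approx> a * z"
        by (rule cong_mult_left[OF a cong_sym[OF z]])
      finally show ?thesis .
    qed
    with zF show "central z" by (simp add: central_def)
  qed
qed

end

theorem theorem4p3:
  fixes \<Lambda> :: "('o, 'm, 'k::finite) kgraph"
  assumes "k_graph \<Lambda>"
    and "row_finite \<Lambda>"
    and "no_sources \<Lambda>"
    and "alg_simple (kp_alg TYPE('f::field) \<Lambda>)"
  shows "(finite (Obj \<Lambda>) \<longrightarrow>
            alg_center (kp_alg TYPE('f) \<Lambda>) =
              {ascale (kp_alg TYPE('f) \<Lambda>) c (kp_one TYPE('f) \<Lambda>) | c. True})
       \<and> (infinite (Obj \<Lambda>) \<longrightarrow>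
            alg_center (kp_alg TYPE('f) \<Lambda>) = {azero (kp_alg TYPE('f) \<Lambda>)})"
proof -
  interpret k_graph \<Lambda> by (rule assms(1))
  interpret simple_kumjian_pask \<Lambda> "TYPE('f)"
    by unfold_locales (rule assms)+
  have Q: "kp_alg TYPE('f) \<Lambda> = Q" by (simp add: kp_alg_def)
  let ?e = "\<Sum>v\<in>Obj \<Lambda>. vertex v"
  have eF: "?e \<in> F" by (intro sum_in_free_carrier vertex_carrier)
  have one: "kp_one TYPE('f) \<Lambda> = coset ?e" by (simp add: kp_one_def)
  have "alg_center Q = {ascale Q c (coset ?e) | c. True}" if fin: "finite (Obj \<Lambda>)"
  proof (intro equalityI subsetI)
    fix X assume "X \<in> alg_center Q"
    then obtain z where z: "central z" "X = coset z" unfolding quot_center by blast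
    from z(1) obtain c where "cong z (Poly_Mapping.single 0 c * ?e)" unfolding center_finite[OF fin] by blast
    then have "X = ascale Q c (coset ?e)" unfolding z(2) quot_scale coset_eq_iff .
    then show "X \<in> {ascale Q c (coset ?e) | c. True}" by blast
  next
    fix X assume "X \<in> {ascale Q c (coset ?e) | c. True}"
    then obtain c where X: "X = coset (Poly_Mapping.single 0 c * ?e)" unfolding quot_scale by blast
    have "central (Poly_Mapping.single 0 c * ?e)"
      unfolding center_finite[OF fin] by (intro conjI exI[of _ c] cong_refl scale_in_free_carrier eF)
    then show "X \<in> alg_center Q" unfolding quot_center X by blast
  qed
  moreover have "alg_center Q = {coset 0}" if inf: "infinite (Obj \<Lambda>)"
  proof (intro equalityI subsetI)
    fix X assume "X \<in> alg_center Q"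
    then obtain z where z: "central z" "X = coset z" unfolding quot_center by blast
    from center_infinite[OF inf z(1)] show "X \<in> {coset 0}"
      unfolding z(2) coset_eq_iff[symmetric] by simp
  next
    fix X assume X: "X \<in> {coset 0}"
    have "central 0" by (simp add: central_def)
    with X show "X \<in> alg_center Q" unfolding quot_center by blast
  qed
  ultimately show ?thesis unfolding Q one quot_zero by blast
qed

end
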